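(* Let $\pi=N(0,\Sigma)$ be a Gaussian distribution on $\mathbb{R}^d$ with positive definite covariance $\Sigma$ and precision matrix $Q=\Sigma^{-1}$, partitioned into blocks $Q=(Q_{ij})_{i,j=1}^s$ with $Q_{ij}$ of size $r_i\times r_j$. For a probability vector $p=(p_1,\dots,p_s)$ with all $p_i>0$, the $L_2$-spectral gap of the Random Scan Gibbs Sampler RSGS($p$) for $\pi$ is $$\mathrm{Gap}(p)=1-\lambda_{\max}(F_1),\qquad F_1=I-K\Big(\sum_{i=1}^s p_iD_i\Big)K,$$ where $K=\sqrt{Q}$ is the symmetric square root of $Q$ and $D_i$ is the $d\times d$ block-diagonal matrix whose $i$-th diagonal block is $(Q_{ii})^{-1}$ and all other blocks are zero.
   Context: RSGS($p$) is the Markov kernel $P_p=\sum_{i=1}^s p_i Pr_i$, where $Pr_i$ replaces the block $x_i\in\mathbb{R}^{r_i}$ of $x=(x_1,\dots,x_s)$ by a draw from the conditional distribution $\pi(x_i\mid x_{-i})$. For $f\in L_2(\mathbb{R}^d,\pi)$ write $\pi(f)=\int f\,d\pi$ and $(P_p f)(x)=\int f(y)P_p(x,dy)$. The $L_2$-rate of convergence $\rho=\rho(p)$ is the smallest number $\rho>0$ such that for all $f\in L_2(\mathbb{R}^d,\pi)$ and all $r>\rho$, $\lim_{n\to\infty} r^{-2n}\mathbb{E}_\pi[\{(P_p^nf)(x)-\pi(f)\}^2]=0$; the $L_2$-spectral gap is $\mathrm{Gap}(p)=1-\rho(p)$. $\lambda_{\max}$ denotes the largest eigenvalue. *)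

theory Defs
  imports "HOL-Probability.Probability"
begin

definition pos_def_mat :: "real^'n^'n \<Rightarrow> bool" where
  "pos_def_mat A \<longleftrightarrow> transpose A = A \<and> (\<forall>x. x \<noteq> 0 \<longrightarrow> x \<bullet> (A *v x) > 0)"

definition gaussian :: "real^'n^'n \<Rightarrow> (real^'n) measure" where
  "gaussian S = density lborel
     (\<lambda>x. ennreal (exp (- (x \<bullet> (matrix_inv S *v x)) / 2) / sqrt ((2 * pi) ^ CARD('n) * det S)))"

definition same_off :: "('n \<Rightarrow> 'b) \<Rightarrow> 'b \<Rightarrow> real^'n \<Rightarrow> real^'n \<Rightarrow> bool" where
  "same_off blk i x y \<longleftrightarrow> (\<forall>j. blk j \<noteq> i \<longrightarrow> x $ j = y $ j)"

text \<open>k is the kernel Pr_i: it keeps x_{-i} and replaces block x_i by a draw from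
  the conditional distribution pi(x_i | x_{-i}) (a regular conditional distribution
  of x given the sigma-algebra generated by x_{-i}).\<close>
definition is_block_conditional ::
  "(real^'n) measure \<Rightarrow> ('n \<Rightarrow> 'b) \<Rightarrow> 'b \<Rightarrow> (real^'n \<Rightarrow> (real^'n) measure) \<Rightarrow> bool" where
  "is_block_conditional \<pi> blk i k \<longleftrightarrow>
     k \<in> borel \<rightarrow>\<^sub>M prob_algebra borel \<and>
     (\<forall>x. emeasure (k x) {y. same_off blk i x y} = 1) \<and>
     (\<forall>x x'. same_off blk i x x' \<longrightarrow> k x = k x') \<and>
     (\<forall>A \<in> sets borel. \<forall>B \<in> sets borel.
        (\<forall>x x'. same_off blk i x x' \<longrightarrow> (x \<in> B \<longleftrightarrow> x' \<in> B)) \<longrightarrow>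
        (\<integral>\<^sup>+ x. indicator B x * emeasure (k x) A \<partial>\<pi>) = emeasure \<pi> (A \<inter> B))"

definition rsgs_op :: "('b::finite \<Rightarrow> real) \<Rightarrow> ('b \<Rightarrow> 'a \<Rightarrow> 'a measure) \<Rightarrow> ('a \<Rightarrow> real) \<Rightarrow> 'a \<Rightarrow> real" where
  "rsgs_op p k f = (\<lambda>x. \<Sum>i\<in>UNIV. p i * (\<integral>y. f y \<partial>(k i x)))"

definition L2_fun :: "'a measure \<Rightarrow> ('a \<Rightarrow> real) \<Rightarrow> bool" where
  "L2_fun \<pi> f \<longleftrightarrow> f \<in> borel_measurable \<pi> \<and> integrable \<pi> (\<lambda>x. (f x)^2)"

definition l2_rate :: "'a measure \<Rightarrow> (('a \<Rightarrow> real) \<Rightarrow> 'a \<Rightarrow> real) \<Rightarrow> real" where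
  "l2_rate \<pi> P = Inf {\<rho>. \<rho> > 0 \<and> (\<forall>f. L2_fun \<pi> f \<longrightarrow> (\<forall>r > \<rho>.
      (\<lambda>n. (1 / r) ^ (2 * n) * (\<integral>x. ((P ^^ n) f x - (\<integral>y. f y \<partial>\<pi>))^2 \<partial>\<pi>)) \<longlonglongrightarrow> 0))}"

definition l2_gap :: "'a measure \<Rightarrow> (('a \<Rightarrow> real) \<Rightarrow> 'a \<Rightarrow> real) \<Rightarrow> real" where
  "l2_gap \<pi> P = 1 - l2_rate \<pi> P"

definition block_inv :: "('n::finite \<Rightarrow> 'b) \<Rightarrow> real^'n^'n \<Rightarrow> 'b \<Rightarrow> real^'n^'n" where
  "block_inv blk Q i = (THE M.
     (\<forall>j l. \<not> (blk j = i \<and> blk l = i) \<longrightarrow> M $ j $ l = 0) \<and>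
     (\<forall>j l. blk j = i \<and> blk l = i \<longrightarrow>
        (\<Sum>m\<in>{m. blk m = i}. M $ j $ m * Q $ m $ l) = (if j = l then 1 else 0)))"

text \<open>Largest eigenvalue of a real square matrix (applied to symmetric matrices).\<close>
definition lambda_max :: "real^'n^'n \<Rightarrow> real" where
  "lambda_max A = Max {c. \<exists>v. v \<noteq> 0 \<and> A *v v = c *\<^sub>R v}"

end

theory Submission
  imports Defs
begin

text \<open>In the coordinates u = K x the conditional expectation given all blocks but the i-th one
  acts on a linear function u -> w . u by the orthogonal projection P i = I - K (D i) K of w, and
  F1 is the average of these projections. An eigenvector of F1 for its largest eigenvalue c thus
  gives a linear eigenfunction, so the rate is at least c. For the upper bound it suffices that
  sum_i p_i <f, E_i f> <= c <f, f> for f of mean zero. For a combination f of functions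
  cos(a_j . u + t_j) both sides are power series in the numbers a_j . P i a_l and a_j . a_l, and the
  inequality holds degree by degree: the degree one case is the definition of c, and higher degrees
  follow by Schur products with Gram matrices since (P i)^(tensor k) <= P i (tensor) I. Such f are
  dense in L2.\<close>

section \<open>Largest eigenvalue and block inverses\<close>

text \<open>Cosines take the place of Hermite polynomials: a conditional expectation turns a cosine
  into a damped cosine, all inner products have a closed form, and boundedness makes every integral
  exist. The degree in the power series plays the role of the Hermite degree; the degree zero terms
  add up to the squared mean, so dropping them amounts to centering. No spectral theory in L2
  enters: the average of the conditional expectations is self-adjoint and nonnegative, hence a bound
  of its quadratic form on mean zero functions bounds its norm there, and this bound is iterated.
  The kernels are arbitrary versions of the conditional laws and are tied to conditional
  expectations only almost everywhere. The latter are computed from an explicit resampling formula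
  with an independent copy of the Gaussian vector. The eigenvalue can be 0, as for a single block,
  whereas an admissible rate is positive; the upper bound is therefore shown for every number above
  the eigenvalue, and the infimum does the rest.\<close>

lemma inner_matrix_symmetric:
  fixes A :: "real^'n^'n"
  assumes "transpose A = A"
  shows "x \<bullet> (A *v y) = (A *v x) \<bullet> y"
  by (metis assms dot_lmul_matrix transpose_matrix_vector)

lemma max_eigenvector_exists:
  fixes A :: "real^'n^'n"
  assumes sym: "transpose A = A"
  obtains v c where "v \<noteq> 0" "A *v v = c *\<^sub>R v" "\<And>x. x \<bullet> (A *v x) \<le> c * (x \<bullet> x)"
proof -
  let ?S = "sphere (0::real^'n) 1"
  have cont: "continuous_on ?S (\<lambda>x. x \<bullet> (A *v x))"
    by (intro continuous_intros)
  have "?S \<noteq> {}" by simp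
  then obtain v where v: "v \<in> ?S" and max: "\<And>x. x \<in> ?S \<Longrightarrow> x \<bullet> (A *v x) \<le> v \<bullet> (A *v v)"
    using continuous_attains_sup[OF compact_sphere _ cont] by blast
  define c where "c = v \<bullet> (A *v v)"
  have vv: "v \<bullet> v = 1" using v by (simp add: dist_norm norm_eq_1)
  have ray: "x \<bullet> (A *v x) \<le> c * (x \<bullet> x)" for x
  proof (cases "x = 0")
    case False
    let ?y = "x /\<^sub>R norm x"
    have "?y \<in> ?S" using False by simp
    from max[OF this] have "(x \<bullet> (A *v x)) / (norm x)^2 \<le> c"
      by (simp add: c_def matrix_vector_mult_scaleR power2_eq_square field_simps)
    then show ?thesis using False by (simp add: field_simps power2_norm_eq_inner)
  qed simp
  define B where "B y = c *\<^sub>R y - A *v y" for y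
  have Bsym: "x \<bullet> B y = B x \<bullet> y" for x y
    by (simp add: B_def inner_diff_left inner_diff_right inner_matrix_symmetric[OF sym])
  have Bpos: "0 \<le> x \<bullet> B x" for x
    using ray[of x] by (simp add: B_def inner_diff_right)
  have Bv: "v \<bullet> B v = 0" by (simp add: B_def inner_diff_right vv c_def)
  have Blin: "B (x + t *\<^sub>R y) = B x + t *\<^sub>R B y" for x y t
    by (simp add: B_def algebra_simps matrix_vector_right_distrib matrix_vector_mult_scaleR)
  \<comment> \<open>A null vector of a positive semidefinite form lies in its kernel.\<close>
  have "B v = 0"
  proof (rule ccontr)
    assume nz: "B v \<noteq> 0"
    define y where "y = B v"
    define a where "a = y \<bullet> y"
    define b where "b = y \<bullet> B y"
    have a: "a > 0" using nz by (simp add: a_def y_def)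
    have b: "b \<ge> 0" using Bpos by (simp add: b_def)
    have q: "0 \<le> 2 * t * a + t^2 * b" for t
    proof -
      have "0 \<le> (v + t *\<^sub>R y) \<bullet> B (v + t *\<^sub>R y)" by (rule Bpos)
      also have "\<dots> = v \<bullet> B v + t * (v \<bullet> B y) + t * (y \<bullet> B v) + t * t * (y \<bullet> B y)"
        by (simp add: Blin algebra_simps)
      also have "v \<bullet> B y = a" by (simp add: Bsym a_def y_def)
      finally show ?thesis by (simp add: Bv a_def b_def y_def power2_eq_square)
    qed
    \<comment> \<open>The parabola 2ta + t^2 b has its minimum at -a/b; the denominator b + 1 also
      covers b = 0 and still gives a negative value.\<close>
    define t where "t = - a / (b + 1)"
    have "2 * t * a + t^2 * b = (a / (b+1))^2 * (b - 2 * (b + 1))"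
    proof -
      have "a = (a / (b+1)) * (b+1)" using b by simp
      then obtain s where s: "a = s * (b+1)" "t = - s" "a / (b+1) = s"
        unfolding t_def minus_divide_left[symmetric] by blast
      show ?thesis unfolding s(3) unfolding s(1,2) by (simp add: power2_eq_square algebra_simps)
    qed
    also have "\<dots> < 0" using a b by (intro mult_pos_neg) auto
    finally show False using q[of t] by simp
  qed
  then have "A *v v = c *\<^sub>R v" by (simp add: B_def)
  moreover have "v \<noteq> 0" using vv by auto
  ultimately show ?thesis using ray that by blast
qed

text \<open>One eigenvector per eigenvalue gives an orthogonal, hence independent, hence finite
  family. The \<open>Max\<close> in \<open>lambda_max\<close> has its meaning only for a finite
  set.\<close>

lemma finite_eigenvalues_symmetric:
  fixes A :: "real^'n^'n"
  assumes sym: "transpose A = A"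
  shows "finite {c. \<exists>v. v \<noteq> 0 \<and> A *v v = c *\<^sub>R v}" (is "finite ?E")
proof -
  have "\<forall>c\<in>?E. \<exists>v. v \<noteq> 0 \<and> A *v v = c *\<^sub>R v" by auto
  from bchoice[OF this] obtain w
    where w: "\<And>c. c \<in> ?E \<Longrightarrow> w c \<noteq> 0 \<and> A *v w c = c *\<^sub>R w c"
    by blast
  have orth: "w c \<bullet> w d = 0" if "c \<in> ?E" "d \<in> ?E" "c \<noteq> d" for c d
  proof -
    have cd: "A *v w c = c *\<^sub>R w c" "A *v w d = d *\<^sub>R w d" using w that(1,2) by blast+
    have "w c \<bullet> (A *v w d) = (A *v w c) \<bullet> w d" by (rule inner_matrix_symmetric[OF sym])
    then have "(d - c) * (w c \<bullet> w d) = 0" unfolding cd by (simp add: left_diff_distrib)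
    then show ?thesis using \<open>c \<noteq> d\<close> by (simp only: mult_eq_0_iff right_minus_eq) blast
  qed
  have inj: "inj_on w ?E"
  proof (rule inj_onI)
    fix c d assume cd: "c \<in> ?E" "d \<in> ?E" "w c = w d"
    show "c = d"
    proof (rule ccontr)
      assume "c \<noteq> d"
      then have "w c \<bullet> w c = 0" using orth[OF cd(1,2)] cd(3) by simp
      with conjunct1[OF w[OF cd(1)]] show False by simp
    qed
  qed
  have "pairwise orthogonal (w ` ?E)"
    unfolding pairwise_def orthogonal_def using orth by blast
  moreover have "0 \<notin> w ` ?E" using w by (metis (no_types, lifting) imageE)
  ultimately have "finite (w ` ?E)"
    using pairwise_orthogonal_independent independent_imp_finite by blast
  then show ?thesis using inj finite_imageD by blast
qed

lemma lambda_max_symmetric: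
  fixes A :: "real^'n^'n"
  assumes sym: "transpose A = A"
  shows "\<exists>v. v \<noteq> 0 \<and> A *v v = lambda_max A *\<^sub>R v"
    and "x \<bullet> (A *v x) \<le> lambda_max A * (x \<bullet> x)"
proof -
  obtain v c where v: "v \<noteq> 0" "A *v v = c *\<^sub>R v" and c: "\<And>x. x \<bullet> (A *v x) \<le> c * (x \<bullet> x)"
    using max_eigenvector_exists[OF sym] by blast
  have "lambda_max A = c"
    unfolding lambda_max_def
  proof (rule Max_eqI)
    show "finite {c. \<exists>v. v \<noteq> 0 \<and> A *v v = c *\<^sub>R v}"
      by (rule finite_eigenvalues_symmetric[OF sym])
    show "c \<in> {c. \<exists>v. v \<noteq> 0 \<and> A *v v = c *\<^sub>R v}" using v by auto
    fix d assume "d \<in> {c. \<exists>v. v \<noteq> 0 \<and> A *v v = c *\<^sub>R v}"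
    then obtain u where u: "u \<noteq> 0" "A *v u = d *\<^sub>R u" by auto
    then have "d * (u \<bullet> u) \<le> c * (u \<bullet> u)" using c[of u] by simp
    then show "d \<le> c" using u by simp
  qed
  then show "\<exists>v. v \<noteq> 0 \<and> A *v v = lambda_max A *\<^sub>R v"
    "x \<bullet> (A *v x) \<le> lambda_max A * (x \<bullet> x)"
    using v c by auto
qed

section \<open>Inverses of positive definite matrices and of their diagonal blocks\<close>

lemma pos_def_mat_inv:
  fixes S :: "real^'n^'n"
  assumes "pos_def_mat S"
  shows "pos_def_mat (matrix_inv S)" "S ** matrix_inv S = mat 1" "matrix_inv S ** S = mat 1"
proof -
  have "x = 0" if "S *v x = 0" for x
    using assms that unfolding pos_def_mat_def by (metis inner_zero_right less_irrefl)
  then have "\<exists>B. B ** S = mat 1" using matrix_left_invertible_ker by blast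
  then have inv: "invertible S" using invertible_left_inverse by blast
  then have "S ** matrix_inv S = mat 1 \<and> matrix_inv S ** S = mat 1"
    unfolding invertible_def matrix_inv_def by (rule someI_ex)
  then show r: "S ** matrix_inv S = mat 1" and l: "matrix_inv S ** S = mat 1" by auto
  have sym: "transpose S = S" using assms by (simp add: pos_def_mat_def)
  have "transpose (matrix_inv S) ** S = mat 1"
    by (metis matrix_transpose_mul r sym transpose_mat)
  then have t: "transpose (matrix_inv S) = matrix_inv S"
    by (metis matrix_mul_assoc matrix_mul_lid matrix_mul_rid r)
  have "x \<bullet> (matrix_inv S *v x) > 0" if "x \<noteq> 0" for x
  proof -
    define y where "y = matrix_inv S *v x"
    have x: "x = S *v y" by (simp add: y_def matrix_vector_mul_assoc r)
    with that have "y \<noteq> 0" by auto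
    then have "y \<bullet> (S *v y) > 0" using assms by (simp add: pos_def_mat_def)
    then show ?thesis unfolding y_def[symmetric] using x by (simp add: inner_commute)
  qed
  with t show "pos_def_mat (matrix_inv S)" by (simp add: pos_def_mat_def)
qed

text \<open>The property under the \<open>THE\<close> of \<open>block_inv\<close>, named so that
  unique existence can be proved for it.\<close>

definition is_block_inverse :: "('n::finite \<Rightarrow> 'b) \<Rightarrow> real^'n^'n \<Rightarrow> 'b \<Rightarrow> real^'n^'n \<Rightarrow> bool" where
  "is_block_inverse blk Q i M \<longleftrightarrow>
     (\<forall>j l. \<not> (blk j = i \<and> blk l = i) \<longrightarrow> M $ j $ l = 0) \<and>
     (\<forall>j l. blk j = i \<and> blk l = i \<longrightarrow>
        (\<Sum>m\<in>{m. blk m = i}. M $ j $ m * Q $ m $ l) = (if j = l then 1 else 0))"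

lemma block_inverse_unique_existence:
  fixes Q :: "real^'n^'n"
  assumes Q: "pos_def_mat Q"
  shows "\<exists>!M. is_block_inverse blk Q i M"
proof -
  \<comment> \<open>Pad the block with the identity, so that it becomes an invertible matrix of full size.\<close>
  define T :: "real^'n^'n" where "T = (\<chi> j l. if blk j = i \<and> blk l = i then Q $ j $ l
     else if j = l then 1 else 0)"
  define off :: "real^'n^'n" where "off = (\<chi> j l. if j = l \<and> blk j \<noteq> i then 1 else 0)"
  have "x = 0" if Tx: "T *v x = 0" for x
  proof -
    define y :: "real^'n" where "y = (\<chi> j. if blk j = i then x $ j else 0)"
    have offx: "x $ j = 0" if "blk j \<noteq> i" for j
    proof -
      have "(T *v x) $ j = (\<Sum>l\<in>UNIV. (if j = l then 1 else 0) * x $ l)"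
        unfolding matrix_vector_mult_def T_def using that by (auto intro!: sum.cong)
      also have "\<dots> = (\<Sum>l\<in>UNIV. if j = l then x $ l else 0)"
        by (intro sum.cong) auto
      finally show ?thesis using Tx by simp
    qed
    then have yx: "y = x" by (auto simp: y_def vec_eq_iff)
    have Tj: "(T *v x) $ j = (Q *v x) $ j" if "blk j = i" for j
      unfolding matrix_vector_mult_def T_def using that offx by (auto intro!: sum.cong)
    \<comment> \<open>A null vector of \<open>T\<close> vanishes off the block, and on the block
      \<open>Q *v x\<close> vanishes; one factor is zero in either case, so positive definiteness of
      \<open>Q\<close> applies.\<close>
    have "x $ j * (Q *v x) $ j = 0" for j
      using Tj[of j] offx[of j] Tx by (cases "blk j = i") auto
    then have "x \<bullet> (Q *v x) = 0" unfolding inner_vec_def by (simp add: sum.neutral)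
    then show ?thesis using Q by (auto simp: pos_def_mat_def) 
  qed
  then obtain V where VT: "V ** T = mat 1" using matrix_left_invertible_ker by blast
  then have TV: "T ** V = mat 1" using matrix_left_right_inverse by blast
  define M :: "real^'n^'n" where "M = (\<chi> j l. if blk j = i \<and> blk l = i then V $ j $ l else 0)"
  have "is_block_inverse blk Q i M"
    unfolding is_block_inverse_def
  proof (intro conjI allI impI)
    fix j l assume "\<not> (blk j = i \<and> blk l = i)" then show "M $ j $ l = 0" by (auto simp: M_def)
  next
    fix j l assume b: "blk j = i \<and> blk l = i"
    have "(\<Sum>m\<in>{m. blk m = i}. M $ j $ m * Q $ m $ l) = (\<Sum>m\<in>UNIV. V $ j $ m * T $ m $ l)"
      using b by (intro sum.mono_neutral_cong_left) (auto simp: M_def T_def)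
    also have "\<dots> = (V ** T) $ j $ l" by (simp add: matrix_matrix_mult_def)
    finally show "(\<Sum>m\<in>{m. blk m = i}. M $ j $ m * Q $ m $ l) = (if j = l then 1 else 0)"
      by (simp add: VT mat_def)
  qed
  moreover have "M' = M''" if "is_block_inverse blk Q i M'" "is_block_inverse blk Q i M''" for M' M''
  proof -
    \<comment> \<open>Every block inverse, padded by the identity off the block, is a left inverse
      of \<open>T\<close>; this forces uniqueness.\<close>
    have "N + off = V" if N: "is_block_inverse blk Q i N" for N
    proof -
      have "((N + off) ** T) $ j $ l = mat 1 $ j $ l" for j l
      proof -
        have "((N + off) ** T) $ j $ l = (\<Sum>m\<in>UNIV. N $ j $ m * T $ m $ l) + (\<Sum>m\<in>UNIV. off $ j $ m * T $ m $ l)"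
          by (simp add: matrix_matrix_mult_def algebra_simps sum.distrib)
        also have "(\<Sum>m\<in>UNIV. off $ j $ m * T $ m $ l) = (\<Sum>m\<in>UNIV. if m = j then (if blk j \<noteq> i then T $ j $ l else 0) else 0)"
          by (intro sum.cong) (auto simp: off_def)
        also have "\<dots> = (if blk j \<noteq> i then T $ j $ l else 0)" by simp
        also have "(\<Sum>m\<in>UNIV. N $ j $ m * T $ m $ l) = (if blk j = i \<and> blk l = i then (if j = l then 1 else 0) else 0)"
        proof (cases "blk j = i \<and> blk l = i")
          case True
          have "(\<Sum>m\<in>UNIV. N $ j $ m * T $ m $ l) = (\<Sum>m\<in>{m. blk m = i}. N $ j $ m * Q $ m $ l)"
            using True N by (intro sum.mono_neutral_cong_right) (auto simp: T_def is_block_inverse_def)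
          then show ?thesis using True N by (auto simp: is_block_inverse_def)
        next
          case False
          then have "N $ j $ m * T $ m $ l = 0" for m
            using N by (auto simp: T_def is_block_inverse_def)
          then have "(\<Sum>m\<in>UNIV. N $ j $ m * T $ m $ l) = 0" by (intro sum.neutral) blast
          then show ?thesis using False by (metis (full_types))
        qed
        finally show ?thesis by (auto simp: T_def mat_def)
      qed
      then have "(N + off) ** T = mat 1" by (simp add: vec_eq_iff)
      then show ?thesis by (metis TV matrix_mul_assoc matrix_mul_lid matrix_mul_rid)
    qed
    then show ?thesis using that by (metis add_right_cancel)
  qed
  ultimately show ?thesis by blast
qed

lemma block_inv_is_block_inverse:
  fixes Q :: "real^'n^'n"
  assumes Q: "pos_def_mat Q"
  shows "is_block_inverse blk Q i (block_inv blk Q i)"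
  using theI'[OF block_inverse_unique_existence[OF Q, of blk i]]
  unfolding block_inv_def is_block_inverse_def .

lemma block_inv_mult:
  fixes Q :: "real^'n^'n"
  assumes Q: "pos_def_mat Q" and "blk j = i" "blk l = i"
  shows "(block_inv blk Q i ** Q) $ j $ l = (if j = l then 1 else 0)"
proof -
  have "(block_inv blk Q i ** Q) $ j $ l = (\<Sum>m\<in>{m. blk m = i}. block_inv blk Q i $ j $ m * Q $ m $ l)"
    unfolding matrix_matrix_mult_def vec_lambda_beta
  proof (rule sum.mono_neutral_right)
    show "\<forall>m\<in>UNIV - {m. blk m = i}. block_inv blk Q i $ j $ m * Q $ m $ l = 0"
      using block_inv_is_block_inverse[OF Q, of blk i] by (auto simp: is_block_inverse_def)
  qed auto
  then show ?thesis
    using block_inv_is_block_inverse[OF Q, of blk i] assms by (auto simp: is_block_inverse_def)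
qed

lemma block_inv_vec_support:
  fixes Q :: "real^'n^'n"
  assumes Q: "pos_def_mat Q" and "blk j \<noteq> i"
  shows "(block_inv blk Q i *v x) $ j = 0"
  using block_inv_is_block_inverse[OF Q, of blk i] assms
  by (auto simp: is_block_inverse_def matrix_vector_mult_def)

text \<open>The source of idempotence and symmetry of K D_i K, and of the fact that a change of
  block i alone is invisible to the complementary projection.\<close>

lemma block_inv_mult_vec:
  fixes Q :: "real^'n^'n"
  assumes Q: "pos_def_mat Q" and supp: "\<And>j. blk j \<noteq> i \<Longrightarrow> x $ j = 0"
  shows "block_inv blk Q i *v (Q *v x) = x"
proof -
  have "(block_inv blk Q i *v (Q *v x)) $ j = x $ j" for j
  proof (cases "blk j = i")
    case True
    have "(block_inv blk Q i *v (Q *v x)) $ j = (\<Sum>l\<in>UNIV. (block_inv blk Q i ** Q) $ j $ l * x $ l)"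
      unfolding matrix_vector_mul_assoc unfolding matrix_vector_mult_def by simp
    also have "\<dots> = (\<Sum>l\<in>UNIV. (if j = l then 1 else 0) * x $ l)"
    proof (rule sum.cong)
      fix l show "(block_inv blk Q i ** Q) $ j $ l * x $ l = (if j = l then 1 else 0) * x $ l"
        using block_inv_mult[OF Q, of blk j i l] True supp[of l] by (cases "blk l = i") auto
    qed simp
    also have "\<dots> = (\<Sum>l\<in>UNIV. if j = l then x $ l else 0)"
      by (intro sum.cong) auto
    finally show ?thesis by simp
  next
    case False
    then show ?thesis using supp by (simp add: block_inv_vec_support[OF Q])
  qed
  then show ?thesis by (simp add: vec_eq_iff)
qed

lemma block_inv_idem:
  fixes Q :: "real^'n^'n"
  assumes Q: "pos_def_mat Q"
  shows "block_inv blk Q i ** Q ** block_inv blk Q i = block_inv blk Q i"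
proof -
  have "block_inv blk Q i *v (Q *v (block_inv blk Q i *v x)) = block_inv blk Q i *v x" for x
    by (rule block_inv_mult_vec[OF Q]) (rule block_inv_vec_support[OF Q])
  then show ?thesis by (auto simp: matrix_eq matrix_vector_mul_assoc matrix_mul_assoc)
qed

text \<open>D Q D^T equals D^T, because the columns of D^T are supported in the block; but D Q D^T
  is symmetric.\<close>

lemma block_inv_transpose:
  fixes Q :: "real^'n^'n"
  assumes Q: "pos_def_mat Q"
  shows "transpose (block_inv blk Q i) = block_inv blk Q i"
proof -
  let ?D = "block_inv blk Q i"
  have sQ: "transpose Q = Q" using Q by (simp add: pos_def_mat_def)
  have "?D *v (Q *v (transpose ?D *v x)) = transpose ?D *v x" for x
    using block_inv_is_block_inverse[OF Q, of blk i]
    by (intro block_inv_mult_vec[OF Q])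
       (auto simp: is_block_inverse_def matrix_vector_mult_def transpose_def)
  then have 1: "?D ** Q ** transpose ?D = transpose ?D"
    unfolding matrix_eq by (simp only: matrix_vector_mul_assoc[symmetric] simp_thms)
  then have "transpose (?D ** Q ** transpose ?D) = ?D" by simp
  moreover have "transpose (?D ** Q ** transpose ?D) = ?D ** Q ** transpose ?D"
    by (simp add: matrix_transpose_mul sQ matrix_mul_assoc)
  ultimately show ?thesis using 1 by simp
qed

section \<open>Gaussian measures\<close>

lemma nn_integral_lborel_translate:
  fixes f :: "'a::euclidean_space \<Rightarrow> ennreal"
  assumes [measurable]: "f \<in> borel_measurable borel"
  shows "(\<integral>\<^sup>+x. f (x + t) \<partial>lborel) = (\<integral>\<^sup>+x. f x \<partial>lborel)"
proof -
  have "(\<integral>\<^sup>+x. f x \<partial>lborel) = (\<integral>\<^sup>+x. f x \<partial>distr lborel borel ((+) t))"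
    by (simp add: lborel_distr_plus)
  also have "\<dots> = (\<integral>\<^sup>+x. f (x + t) \<partial>lborel)"
    by (subst nn_integral_distr) (auto simp: add.commute)
  finally show ?thesis by simp
qed

text \<open>Fubini with the coordinate along \<open>b\<close> innermost: on each line parallel to
  \<open>b\<close> the function \<open>g\<close> is constant, so the map is a translation
  there.\<close>

lemma nn_integral_lborel_shear:
  fixes f :: "'a::euclidean_space \<Rightarrow> ennreal" and g :: "'a \<Rightarrow> real"
  assumes f[measurable]: "f \<in> borel_measurable borel" and g[measurable]: "g \<in> borel_measurable borel"
    and b: "b \<in> Basis" and inv: "\<And>x t. g (x + t *\<^sub>R b) = g x"
  shows "(\<integral>\<^sup>+x. f (x + g x *\<^sub>R b) \<partial>lborel) = (\<integral>\<^sup>+x. f x \<partial>lborel)"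
proof -
  interpret product_sigma_finite "\<lambda>_::'a. lborel :: real measure" by standard
  define I where "I = (Basis :: 'a set) - {b}"
  have I: "finite I" "b \<notin> I" "insert b I = Basis" using b by (auto simp: I_def)
  have M: "(\<lambda>h. \<Sum>c\<in>Basis. h c *\<^sub>R c) \<in> (\<Pi>\<^sub>M c\<in>Basis. lborel) \<rightarrow>\<^sub>M (borel :: 'a measure)"
    by measurable
  have fub: "(\<integral>\<^sup>+x. F x \<partial>lborel) =
     (\<integral>\<^sup>+h. \<integral>\<^sup>+y. F ((\<Sum>c\<in>I. h c *\<^sub>R c) + y *\<^sub>R b) \<partial>lborel \<partial>(\<Pi>\<^sub>M c\<in>I. lborel))"
    if [measurable]: "F \<in> borel_measurable borel" for F :: "'a \<Rightarrow> ennreal"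
  proof -
    have "(\<integral>\<^sup>+x. F x \<partial>lborel) = (\<integral>\<^sup>+h. F (\<Sum>c\<in>Basis. h c *\<^sub>R c) \<partial>(\<Pi>\<^sub>M c\<in>Basis. lborel))"
      by (subst lborel_eq) (simp add: nn_integral_distr)
    also have "\<dots> = (\<integral>\<^sup>+h. \<integral>\<^sup>+y. F (\<Sum>c\<in>Basis. (h(b := y)) c *\<^sub>R c) \<partial>lborel \<partial>(\<Pi>\<^sub>M c\<in>I. lborel))"
      unfolding I(3)[symmetric] by (subst product_nn_integral_insert[OF I(1,2)]) (auto simp: I(3))
    also have "\<dots> = (\<integral>\<^sup>+h. \<integral>\<^sup>+y. F ((\<Sum>c\<in>I. h c *\<^sub>R c) + y *\<^sub>R b) \<partial>lborel \<partial>(\<Pi>\<^sub>M c\<in>I. lborel))"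
    proof -
      have "(\<Sum>c\<in>Basis. (h(b := y)) c *\<^sub>R c) = (\<Sum>c\<in>I. h c *\<^sub>R c) + y *\<^sub>R b" for h and y :: real
      proof -
        have "(\<Sum>c\<in>insert b I. (h(b := y)) c *\<^sub>R c) = y *\<^sub>R b + (\<Sum>c\<in>I. (h(b := y)) c *\<^sub>R c)"
          using I by (subst sum.insert) auto
        also have "(\<Sum>c\<in>I. (h(b := y)) c *\<^sub>R c) = (\<Sum>c\<in>I. h c *\<^sub>R c)"
          using I by (intro sum.cong) auto
        finally show ?thesis by (simp add: I(3) add.commute)
      qed
      then show ?thesis by simp
    qed
    finally show ?thesis .
  qed
  have [measurable]: "(\<lambda>x. f (x + g x *\<^sub>R b)) \<in> borel_measurable borel" by measurable
  have "(\<integral>\<^sup>+y. f (z + y *\<^sub>R b + g (z + y *\<^sub>R b) *\<^sub>R b) \<partial>lborel) = (\<integral>\<^sup>+y. f (z + y *\<^sub>R b) \<partial>lborel)" for z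
  proof -
    have "(\<integral>\<^sup>+y. f (z + y *\<^sub>R b + g (z + y *\<^sub>R b) *\<^sub>R b) \<partial>lborel) =
        (\<integral>\<^sup>+y. (\<lambda>y. f (z + y *\<^sub>R b)) (y + g z) \<partial>lborel)"
      by (simp add: inv algebra_simps)
    also have "\<dots> = (\<integral>\<^sup>+y. f (z + y *\<^sub>R b) \<partial>lborel)"
      by (rule nn_integral_lborel_translate) measurable
    finally show ?thesis .
  qed
  then show ?thesis by (subst (1 2) fub) auto
qed

lemma Basis_real_vec: "(Basis :: (real^'n) set) = range (\<lambda>i. axis i 1)"
  by (auto simp: Basis_vec_def)

lemma prod_Basis_real_vec: "(\<Prod>b\<in>(Basis :: (real^'n) set). h b) = (\<Prod>i\<in>UNIV. h (axis i 1))"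
  unfolding Basis_real_vec by (subst prod.reindex) (auto simp: inj_on_def axis_eq_axis)

text \<open>The linear change of variables of the library needs a well-ordered index type.\<close>

lemma nn_integral_lborel_linear:
  fixes A :: "real^'n^'n" and f :: "real^'n \<Rightarrow> ennreal"
  assumes "det A \<noteq> 0" "f \<in> borel_measurable borel"
  shows "ennreal \<bar>det A\<bar> * (\<integral>\<^sup>+x. f (A *v x) \<partial>lborel) = (\<integral>\<^sup>+x. f x \<partial>lborel)"
proof -
  define P where "P A \<longleftrightarrow> (det A \<noteq> 0 \<longrightarrow> (\<forall>f\<in>borel_measurable borel.
     ennreal \<bar>det A\<bar> * (\<integral>\<^sup>+x. f (A *v x) \<partial>lborel) = (\<integral>\<^sup>+x. f x \<partial>lborel)))" for A :: "real^'n^'n"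
  have meas[measurable]: "(\<lambda>x. C *v x) \<in> borel_measurable borel" for C :: "real^'n^'n"
    by (intro borel_measurable_continuous_onI continuous_intros)
  have "P A"
  \<comment> \<open>Every square matrix is built by products from matrices with a zero row, diagonal
    matrices, coordinate swaps and shears. The first kind is excluded by the determinant; the others
    are scalings, measure preserving permutations and translations along lines.\<close>
  proof (rule induct_matrix_elementary)
    fix A B assume AB: "P A" "P B"
    show "P (A ** B)"
      unfolding P_def
    proof (intro impI ballI)
      fix f :: "real^'n \<Rightarrow> ennreal"
      assume d: "det (A ** B) \<noteq> 0" and [measurable]: "f \<in> borel_measurable borel"
      have nz: "det A \<noteq> 0" "det B \<noteq> 0" using d by (auto simp: det_mul)
      have "(\<integral>\<^sup>+x. f x \<partial>lborel) = ennreal \<bar>det A\<bar> * (\<integral>\<^sup>+x. f (A *v x) \<partial>lborel)"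
        using AB(1) nz unfolding P_def by simp
      also have "(\<integral>\<^sup>+x. f (A *v x) \<partial>lborel) = ennreal \<bar>det B\<bar> * (\<integral>\<^sup>+x. f (A *v (B *v x)) \<partial>lborel)"
        using AB(2) nz unfolding P_def by (auto dest!: bspec[of _ _ "\<lambda>x. f (A *v x)"])
      finally show "ennreal \<bar>det (A ** B)\<bar> * (\<integral>\<^sup>+x. f ((A ** B) *v x) \<partial>lborel) = (\<integral>\<^sup>+x. f x \<partial>lborel)"
        by (simp add: det_mul abs_mult ennreal_mult matrix_vector_mul_assoc mult.assoc)
    qed
  next
    fix A :: "real^'n^'n" and i assume "row i A = 0"
    then show "P A" by (simp add: P_def det_zero_row)
  next
    fix A :: "real^'n^'n" assume diag: "\<And>i j. i \<noteq> j \<Longrightarrow> A $ i $ j = 0"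
    show "P A"
      unfolding P_def
    proof (intro impI ballI)
      fix f :: "real^'n \<Rightarrow> ennreal"
      assume d: "det A \<noteq> 0" and [measurable]: "f \<in> borel_measurable borel"
      have detA: "det A = (\<Prod>i\<in>UNIV. A $ i $ i)" using diag by (rule det_diagonal)
      have comp: "(A *v x) $ i = A $ i $ i * x $ i" for x i
      proof -
        have "(A *v x) $ i = (\<Sum>j\<in>UNIV. if j = i then A $ i $ i * x $ i else 0)"
          unfolding matrix_vector_mult_def vec_lambda_beta by (intro sum.cong) (auto simp: diag)
        then show ?thesis by simp
      qed
      define c where "c b = (A *v b) \<bullet> b" for b
      have c: "c (axis i 1) = A $ i $ i" for i
        by (simp add: c_def inner_axis comp)
      have T: "(\<Sum>j\<in>Basis. (c j * (x \<bullet> j)) *\<^sub>R j) = A *v x" for x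
      proof -
        have "A *v x = (\<Sum>j\<in>Basis. ((A *v x) \<bullet> j) *\<^sub>R j)" by (simp add: euclidean_representation)
        also have "\<dots> = (\<Sum>j\<in>Basis. (c j * (x \<bullet> j)) *\<^sub>R j)"
          by (intro sum.cong) (auto simp: Basis_real_vec c inner_axis comp)
        finally show ?thesis by simp
      qed
      have nz: "c j \<noteq> 0" if "j \<in> Basis" for j
        using that d by (auto simp: Basis_real_vec c detA)
      have "lborel = density (distr lborel borel (\<lambda>x. A *v x)) (\<lambda>_. ennreal (\<Prod>j\<in>Basis. \<bar>c j\<bar>))"
        using lborel_affine_euclidean[where c=c and t=0, OF nz] by (simp add: T)
      also have "(\<Prod>j\<in>Basis. \<bar>c j\<bar>) = \<bar>det A\<bar>"
        by (simp add: prod_Basis_real_vec c detA abs_prod)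
      finally have "(\<integral>\<^sup>+x. f x \<partial>lborel) = (\<integral>\<^sup>+x. f x \<partial>density (distr lborel borel (\<lambda>x. A *v x)) (\<lambda>_. ennreal \<bar>det A\<bar>))"
        by simp
      then show "ennreal \<bar>det A\<bar> * (\<integral>\<^sup>+x. f (A *v x) \<partial>lborel) = (\<integral>\<^sup>+x. f x \<partial>lborel)"
        by (simp add: nn_integral_density nn_integral_distr nn_integral_cmult)
    qed
  next
    fix m n :: 'n assume mn: "m \<noteq> n"
    let ?A = "(\<chi> i j. mat 1 $ i $ Transposition.transpose m n j) :: real^'n^'n"
    let ?t = "Transposition.transpose m n"
    have comp: "(?A *v x) $ i = x $ ?t i" for x i
    proof -
      have "(?A *v x) $ i = (\<Sum>j\<in>UNIV. if j = ?t i then x $ j else 0)"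
        unfolding matrix_vector_mult_def vec_lambda_beta
        by (intro sum.cong) (auto simp: mat_def)
      then show ?thesis by simp
    qed
    have "?A *v (?A *v x) = x" for x by (simp add: vec_eq_iff comp)
    then have "?A ** ?A = mat 1" by (simp add: matrix_eq matrix_vector_mul_assoc)
    then have "det ?A * det ?A = 1" by (metis det_I det_mul)
    then have det: "\<bar>det ?A\<bar> = 1" unfolding power2_eq_square[symmetric] abs_square_eq_1 .
    \<comment> \<open>Lebesgue measure is determined by its values on boxes, and a swap maps boxes
      to boxes with permuted side lengths.\<close>
    have swap: "lborel = distr lborel borel (\<lambda>x. ?A *v x)"
    proof (rule lborel_eqI)
      fix l u :: "real^'n" assume lu: "\<And>b. b \<in> Basis \<Longrightarrow> l \<bullet> b \<le> u \<bullet> b"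
      have lu': "l $ i \<le> u $ i" for i using lu[of "axis i 1"] by (simp add: inner_axis)
      have swap_all: "(\<forall>i. R i (?t i)) \<longleftrightarrow> (\<forall>i. R (?t i) i)" for R :: "'n \<Rightarrow> 'n \<Rightarrow> bool"
        by (metis transpose_involutory)
      have pre: "(\<lambda>x. ?A *v x) -` box l u = box (?A *v l) (?A *v u)"
      proof (intro set_eqI)
        fix x
        have "x \<in> (\<lambda>x. ?A *v x) -` box l u \<longleftrightarrow> (\<forall>i. l $ i < x $ ?t i \<and> x $ ?t i < u $ i)"
          by (simp only: vimage_eq mem_box_cart comp)
        also have "\<dots> \<longleftrightarrow> (\<forall>i. l $ ?t i < x $ i \<and> x $ i < u $ ?t i)"
          using swap_all[of "\<lambda>i j. l $ i < x $ j \<and> x $ j < u $ i"] by simp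
        also have "\<dots> \<longleftrightarrow> x \<in> box (?A *v l) (?A *v u)"
          by (simp only: mem_box_cart comp)
        finally show "x \<in> (\<lambda>x. ?A *v x) -` box l u \<longleftrightarrow> x \<in> box (?A *v l) (?A *v u)" .
      qed
      have "emeasure (distr lborel borel (\<lambda>x. ?A *v x)) (box l u) = emeasure lborel (box (?A *v l) (?A *v u))"
        by (subst emeasure_distr) (simp_all only: pre, auto)
      also have "\<dots> = ennreal (\<Prod>b\<in>Basis. (?A *v u - ?A *v l) \<bullet> b)"
        by (rule emeasure_lborel_box) (auto simp only: Basis_real_vec inner_axis comp lu' inner_real_def mult_1_right)
      also have "(\<Prod>b\<in>Basis. (?A *v u - ?A *v l) \<bullet> b) = (\<Prod>i\<in>UNIV. (u - l) $ ?t i)"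
        unfolding prod_Basis_real_vec by (simp only: inner_axis vector_minus_component comp) simp
      also have "\<dots> = (\<Prod>i\<in>UNIV. (u - l) $ i)"
        by (rule prod.reindex_bij_betw) simp
      also have "\<dots> = (\<Prod>b\<in>Basis. (u - l) \<bullet> b)"
        unfolding prod_Basis_real_vec by (simp only: inner_axis) simp
      finally show "emeasure (distr lborel borel (\<lambda>x. ?A *v x)) (box l u) = ennreal (\<Prod>b\<in>Basis. (u - l) \<bullet> b)" .
    qed simp
    have "(\<integral>\<^sup>+x. f (?A *v x) \<partial>lborel) = (\<integral>\<^sup>+x. f x \<partial>lborel)" if "f \<in> borel_measurable borel" for f
    proof -
      have "(\<integral>\<^sup>+x. f (?A *v x) \<partial>lborel) = (\<integral>\<^sup>+x. f x \<partial>distr lborel borel (\<lambda>x. ?A *v x))"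
        using that by (intro nn_integral_distr[symmetric]) auto
      then show ?thesis by (simp only: swap[symmetric])
    qed
    then show "P ?A" unfolding P_def det by simp
  next
    fix m n :: 'n and c :: real assume mn: "m \<noteq> n"
    let ?A = "(\<chi> i j. if i = m \<and> j = n then c else of_bool (i = j)) :: real^'n^'n"
    have "?A = (\<chi> k. if k = m then row m (mat 1) + c *s row n (mat 1) else row k (mat 1))"
      using mn by (auto simp: vec_eq_iff row_def mat_def)
    then have det: "det ?A = 1" by (simp only: det_row_operation[OF mn] det_I)
    have Ax: "?A *v x = x + (c * x $ n) *\<^sub>R axis m 1" for x
    proof -
      have "(?A *v x) $ i = (x + (c * x $ n) *\<^sub>R axis m 1) $ i" for i
      proof -
        have "(?A *v x) $ i = (\<Sum>j\<in>UNIV. (if j = i then x $ j else 0) + (if j = n then (if i = m then c * x $ j else 0) else 0))"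
          unfolding matrix_vector_mult_def vec_lambda_beta using mn by (intro sum.cong) auto
        also have "\<dots> = x $ i + (if i = m then c * x $ n else 0)"
          unfolding sum.distrib by simp
        finally show ?thesis by (auto simp: axis_def)
      qed
      then show ?thesis by (simp add: vec_eq_iff)
    qed
    have "(\<integral>\<^sup>+x. f (?A *v x) \<partial>lborel) = (\<integral>\<^sup>+x. f x \<partial>lborel)" if "f \<in> borel_measurable borel" for f
      unfolding Ax using that mn
      by (intro nn_integral_lborel_shear) (auto simp: Basis_real_vec axis_def)
    then show "P ?A" unfolding P_def det by simp
  qed
  then show ?thesis using assms by (simp add: P_def)
qed

section \<open>The standard Gaussian measure\<close>

definition std_gauss :: "'a::euclidean_space measure" where
  "std_gauss = density lborel (\<lambda>u. ennreal (\<Prod>b\<in>Basis. std_normal_density (u \<bullet> b)))"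

lemma sum_Basis_half_squares:
  "(\<Sum>b\<in>Basis. - (u \<bullet> b)\<^sup>2 / 2) = - (u \<bullet> u) / 2"
  unfolding euclidean_inner[of u u] by (simp add: sum_negf sum_divide_distrib power2_eq_square)

lemma std_gauss_density_eq:
  "(\<Prod>b\<in>(Basis :: 'a::euclidean_space set). std_normal_density (u \<bullet> b)) =
     exp (- (u \<bullet> u) / 2) / sqrt ((2 * pi) ^ DIM('a))"
proof -
  have "(\<Prod>b\<in>(Basis :: 'a set). std_normal_density (u \<bullet> b)) =
      (\<Prod>b\<in>(Basis :: 'a set). 1 / sqrt (2 * pi)) * exp (\<Sum>b\<in>Basis. - (u \<bullet> b)\<^sup>2 / 2)"
    unfolding std_normal_density_def prod.distrib by (simp add: exp_sum)
  also note sum_Basis_half_squares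
  finally show ?thesis by (simp add: real_sqrt_power[symmetric] power_divide)
qed

lemma prob_space_std_gauss: "prob_space (std_gauss :: 'a::euclidean_space measure)"
proof
  have "emeasure (std_gauss :: 'a measure) (space std_gauss) =
      (\<integral>\<^sup>+u. (\<Prod>b\<in>Basis. ennreal (std_normal_density ((u::'a) \<bullet> b))) \<partial>lborel)"
    by (simp add: std_gauss_def emeasure_density prod_ennreal)
  also have "\<dots> = (\<Prod>b\<in>(Basis :: 'a set). (\<integral>\<^sup>+y. ennreal (std_normal_density y) \<partial>lborel))"
    by (rule nn_integral_lborel_prod) auto
  also have "(\<integral>\<^sup>+y. ennreal (std_normal_density y) \<partial>lborel) = 1"
    using prob_space.emeasure_space_1[OF prob_space_normal_density[of 1 0]]
    by (simp add: emeasure_density)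
  finally show "emeasure (std_gauss :: 'a measure) (space std_gauss) = 1" by simp
qed

text \<open>Density and exponential are both products over the coordinates, so Fubini reduces the
  claim to the one-dimensional characteristic function.\<close>

lemma char_std_gauss:
  fixes w :: "'a::euclidean_space"
  shows "(CLINT u|std_gauss. iexp (w \<bullet> u)) = complex_of_real (exp (- (w \<bullet> w) / 2))"
proof -
  interpret product_sigma_finite "\<lambda>_::'a. lborel :: real measure" by standard
  define h where "h b y = std_normal_density y *\<^sub>R iexp ((w \<bullet> b) * y)" for b y
  have int: "integrable lborel (h b)" for b
  proof -
    interpret prob_space std_normal_distribution by (rule prob_space_normal_density) simp
    have "integrable std_normal_distribution (\<lambda>y. iexp ((w \<bullet> b) * y))"
      by (rule integrable_iexp) auto
    then show ?thesis unfolding h_def by (subst (asm) integrable_density) auto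
  qed
  have val: "integral\<^sup>L lborel (h b) = complex_of_real (exp (- (w \<bullet> b)\<^sup>2 / 2))" for b
  proof -
    have "integral\<^sup>L lborel (h b) = char std_normal_distribution (w \<bullet> b)"
      unfolding h_def char_def by (subst integral_density) auto
    then show ?thesis by (simp add: char_std_normal_distribution)
  qed
  have "(CLINT u|std_gauss. iexp (w \<bullet> u)) =
      (CLINT u|lborel. (\<Prod>b\<in>Basis. std_normal_density (u \<bullet> b)) *\<^sub>R iexp (w \<bullet> u))"
    unfolding std_gauss_def by (subst integral_density) (auto intro!: prod_nonneg)
  also have "(\<lambda>u. (\<Prod>b\<in>Basis. std_normal_density (u \<bullet> b)) *\<^sub>R iexp (w \<bullet> u)) = (\<lambda>u. \<Prod>b\<in>Basis. h b (u \<bullet> b))"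
  proof
    fix u
    have "iexp (w \<bullet> u) = (\<Prod>b\<in>Basis. iexp ((w \<bullet> b) * (u \<bullet> b)))"
      by (subst euclidean_inner) (simp add: exp_sum[symmetric] sum_distrib_left)
    then show "(\<Prod>b\<in>Basis. std_normal_density (u \<bullet> b)) *\<^sub>R iexp (w \<bullet> u) = (\<Prod>b\<in>Basis. h b (u \<bullet> b))"
      unfolding h_def by (simp add: scaleR_conv_of_real prod.distrib)
  qed
  also have "(CLINT u|lborel. \<Prod>b\<in>Basis. h b (u \<bullet> b)) = (CLINT f|(\<Pi>\<^sub>M b\<in>(Basis::'a set). lborel). \<Prod>b\<in>Basis. h b (f b))"
  proof -
    have [measurable]: "h b \<in> borel_measurable borel" for b unfolding h_def by measurable
    show ?thesis by (subst lborel_eq) (simp add: integral_distr cong: prod.cong)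
  qed
  also have "\<dots> = (\<Prod>b\<in>Basis. integral\<^sup>L lborel (h b))"
    by (rule product_integral_prod) (auto intro: int)
  also have "\<dots> = complex_of_real (exp (\<Sum>b\<in>Basis. - (w \<bullet> b)\<^sup>2 / 2))"
    by (simp add: val exp_sum)
  also note sum_Basis_half_squares
  finally show ?thesis .
qed

lemma sets_std_gauss[simp, measurable_cong]: "sets std_gauss = sets borel"
  by (simp add: std_gauss_def)

text \<open>Comparing characteristic functions gives the law in a direction \<open>w\<close> without
  rotating the measure; the moments of linear functions then come from dimension one.\<close>

lemma distr_std_gauss_inner:
  fixes w :: "'a::euclidean_space"
  assumes "norm w = 1"
  shows "distr std_gauss borel (\<lambda>u. w \<bullet> u) = std_normal_distribution"
proof (rule Levy_uniqueness)
  interpret prob_space "std_gauss :: 'a measure" by (rule prob_space_std_gauss)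
  show "real_distribution (distr std_gauss borel (\<lambda>u. w \<bullet> u))"
    by (rule real_distribution_distr) simp
  show "real_distribution std_normal_distribution" by (rule real_dist_normal_dist)
  show "char (distr std_gauss borel (\<lambda>u. w \<bullet> u)) = char std_normal_distribution"
  proof
    fix t
    have "char (distr std_gauss borel (\<lambda>u. w \<bullet> u)) t = (CLINT u|std_gauss. iexp ((t *\<^sub>R w) \<bullet> u))"
      unfolding char_def by (subst integral_distr) auto
    also have "\<dots> = complex_of_real (exp (- t\<^sup>2 / 2))"
      using assms by (subst char_std_gauss) (simp add: power2_eq_square norm_eq_1)
    finally show "char (distr std_gauss borel (\<lambda>u. w \<bullet> u)) t = char std_normal_distribution t"
      by (simp add: char_std_normal_distribution)
  qed
qed

lemma std_gauss_cos:
  fixes a :: "'a::euclidean_space"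
  shows "(\<integral>u. cos (a \<bullet> u + \<theta>) \<partial>std_gauss) = exp (- (a \<bullet> a) / 2) * cos \<theta>"
proof -
  interpret prob_space "std_gauss :: 'a measure" by (rule prob_space_std_gauss)
  have int: "integrable std_gauss (\<lambda>u. iexp (a \<bullet> u))" by (rule integrable_iexp) simp_all
  have "(\<integral>u. cos (a \<bullet> u + \<theta>) \<partial>std_gauss) = (\<integral>u. Re (iexp \<theta> * iexp (a \<bullet> u)) \<partial>std_gauss)"
    by (intro Bochner_Integration.integral_cong) (simp_all only: cis_conv_exp[symmetric] cis_mult cis.sel add.commute Im_complex_of_real)
  also have "\<dots> = Re (CLINT u|std_gauss. iexp \<theta> * iexp (a \<bullet> u))"
    by (rule integral_Re) (use int in simp)
  also have "\<dots> = Re (iexp \<theta> * complex_of_real (exp (- (a \<bullet> a) / 2)))"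
    by (subst Bochner_Integration.integral_mult_right) (simp_all only: int char_std_gauss)
  also have "\<dots> = exp (- (a \<bullet> a) / 2) * cos \<theta>"
    by (simp add: Re_exp)
  finally show ?thesis .
qed

lemma std_gauss_linear:
  fixes w :: "'a::euclidean_space"
  assumes w: "norm w = 1"
  shows "integrable std_gauss (\<lambda>u. (w \<bullet> u)\<^sup>2)" "(\<integral>u. (w \<bullet> u)\<^sup>2 \<partial>std_gauss) = 1"
    "integrable std_gauss (\<lambda>u. w \<bullet> u)" "(\<integral>u. w \<bullet> u \<partial>std_gauss) = 0"
proof -
  have d: "(\<integral>u. (w \<bullet> u)^k \<partial>std_gauss) = (\<integral>y. y^k \<partial>std_normal_distribution)"
    "integrable std_gauss (\<lambda>u. (w \<bullet> u)^k) \<longleftrightarrow> integrable std_normal_distribution (\<lambda>y. y^k)" for k :: nat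
    unfolding distr_std_gauss_inner[OF w, symmetric]
    by (subst integral_distr integrable_distr_eq; simp)+
  show "integrable std_gauss (\<lambda>u. (w \<bullet> u)\<^sup>2)"
    by (simp only: d integrable_std_normal_distribution_moment)
  show "(\<integral>u. (w \<bullet> u)\<^sup>2 \<partial>std_gauss) = 1"
    using std_normal_distribution_even_moments(1)[of 1] by (simp add: d fact_2)
  show "integrable std_gauss (\<lambda>u. w \<bullet> u)"
    using d(2)[of 1] integrable_std_normal_distribution_moment[of 1] by simp
  show "(\<integral>u. w \<bullet> u \<partial>std_gauss) = 0"
    using d(1)[of 1] integral_std_normal_distribution_moment_odd[of 1] by simp
qed

lemma borel_measurable_matrix_vector_mult[measurable (raw)]:
  fixes C :: "real^'n^'m"
  assumes "f \<in> borel_measurable M"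
  shows "(\<lambda>x. C *v f x) \<in> borel_measurable M"
proof -
  have "(\<lambda>x. C *v x) \<in> borel_measurable borel"
    by (intro borel_measurable_continuous_onI continuous_intros)
  then show ?thesis using assms by (rule measurable_compose[rotated])
qed

section \<open>The Gaussian measure with covariance \<open>\<Sigma>\<close> in the coordinates u = K
  x\<close>

locale gaussian_sqrt =
  fixes \<Sigma> K :: "real^'n^'n"
  assumes pd: "pos_def_mat \<Sigma>" and K_sym: "transpose K = K" and K_sq: "K ** K = matrix_inv \<Sigma>"
begin

lemma sets_gaussian[simp, measurable_cong]: "sets (gaussian \<Sigma>) = sets borel"
  by (simp add: gaussian_def)

lemma space_gaussian[simp]: "space (gaussian \<Sigma>) = UNIV"
  by (simp add: gaussian_def)

lemma det_K: "det K \<noteq> 0" "det \<Sigma> * (det K)\<^sup>2 = 1"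
proof -
  have "det (\<Sigma> ** (K ** K)) = 1"
    by (simp add: K_sq pos_def_mat_inv[OF pd])
  then show "det \<Sigma> * (det K)\<^sup>2 = 1" by (simp add: det_mul power2_eq_square)
  then show "det K \<noteq> 0" by auto
qed

lemma K_inner: "x \<bullet> (matrix_inv \<Sigma> *v x) = (K *v x) \<bullet> (K *v x)"
  unfolding K_sq[symmetric] by (metis inner_matrix_symmetric[OF K_sym] matrix_vector_mul_assoc)

definition gauss_dens :: "real^'n \<Rightarrow> real" where
  "gauss_dens x = \<bar>det K\<bar> * (\<Prod>b\<in>Basis. std_normal_density ((K *v x) \<bullet> b))"

lemma gauss_dens_measurable[measurable]: "gauss_dens \<in> borel_measurable borel"
  unfolding gauss_dens_def by measurable

lemma gauss_dens_nonneg: "0 \<le> gauss_dens x" by (simp add: gauss_dens_def prod_nonneg)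

lemma gaussian_eq: "gaussian \<Sigma> = density lborel gauss_dens"
proof -
  have "\<bar>det K\<bar> = 1 / sqrt (det \<Sigma>)"
  proof -
    have "det \<Sigma> = 1 / (det K)\<^sup>2" using det_K by (simp add: field_simps)
    then show ?thesis using det_K by (simp add: real_sqrt_divide)
  qed
  then have "exp (- (x \<bullet> (matrix_inv \<Sigma> *v x)) / 2) / sqrt ((2 * pi) ^ CARD('n) * det \<Sigma>) = gauss_dens x" for x
    unfolding gauss_dens_def std_gauss_density_eq by (simp add: K_inner real_sqrt_mult)
  then show ?thesis unfolding gaussian_def by simp
qed

lemma distr_gaussian: "distr (gaussian \<Sigma>) borel (\<lambda>x. K *v x) = std_gauss"
proof (rule measure_eqI)
  fix A assume "A \<in> sets (distr (gaussian \<Sigma>) borel (\<lambda>x. K *v x))"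
  then have A[measurable]: "A \<in> sets borel" by simp
  have pre[measurable]: "(\<lambda>x. K *v x) -` A \<in> sets borel"
    using measurable_sets[of "\<lambda>x. K *v x" borel borel A] by simp
  have "emeasure (distr (gaussian \<Sigma>) borel (\<lambda>x. K *v x)) A = emeasure (gaussian \<Sigma>) ((\<lambda>x. K *v x) -` A)"
    by (subst emeasure_distr) auto
  also have "\<dots> = (\<integral>\<^sup>+x. ennreal (gauss_dens x) * indicator A (K *v x) \<partial>lborel)"
    unfolding gaussian_eq by (subst emeasure_density) (auto simp: indicator_def intro!: nn_integral_cong)
  also have "\<dots> = ennreal \<bar>det K\<bar> * (\<integral>\<^sup>+x. ennreal (\<Prod>b\<in>Basis. std_normal_density ((K *v x) \<bullet> b)) * indicator A (K *v x) \<partial>lborel)"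
    unfolding gauss_dens_def by (subst nn_integral_cmult[symmetric]) (auto simp: ennreal_mult prod_nonneg mult.assoc)
  also have "\<dots> = (\<integral>\<^sup>+u. ennreal (\<Prod>b\<in>Basis. std_normal_density (u \<bullet> b)) * indicator A u \<partial>lborel)"
    by (rule nn_integral_lborel_linear[OF det_K(1)]) measurable
  also have "\<dots> = emeasure std_gauss A"
    unfolding std_gauss_def by (subst emeasure_density) auto
  finally show "emeasure (distr (gaussian \<Sigma>) borel (\<lambda>x. K *v x)) A = emeasure std_gauss A" .
qed simp

lemma prob_space_gaussian: "prob_space (gaussian \<Sigma>)"
proof -
  have "prob_space (distr (gaussian \<Sigma>) borel (\<lambda>x. K *v x))"
    unfolding distr_gaussian by (rule prob_space_std_gauss)
  then show ?thesis by (rule prob_space_distrD[rotated]) simp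
qed

lemma gaussian_cos: "(\<integral>x. cos (a \<bullet> (K *v x) + \<theta>) \<partial>gaussian \<Sigma>) = exp (- (a \<bullet> a) / 2) * cos \<theta>"
  unfolding std_gauss_cos[symmetric] distr_gaussian[symmetric]
  by (subst integral_distr) auto

lemma gaussian_linear:
  assumes w: "norm w = 1"
  shows "integrable (gaussian \<Sigma>) (\<lambda>x. (w \<bullet> (K *v x))\<^sup>2)" "(\<integral>x. (w \<bullet> (K *v x))\<^sup>2 \<partial>gaussian \<Sigma>) = 1"
    "integrable (gaussian \<Sigma>) (\<lambda>x. w \<bullet> (K *v x))" "(\<integral>x. w \<bullet> (K *v x) \<partial>gaussian \<Sigma>) = 0"
  using std_gauss_linear[OF w] unfolding distr_gaussian[symmetric]
  by (simp_all add: integral_distr integrable_distr_eq)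

text \<open>Three shears compose to the rotation (x, y) -> (x - B x + B y, y - B y - B x), which
  leaves the product of two copies of the Gaussian invariant.\<close>

lemma distr_gaussian_rotation:
  fixes B :: "real^'n^'n"
  assumes idem: "B ** B = B"
    and orth: "\<And>x y. (K *v (x - B *v x + B *v y)) \<bullet> (K *v (x - B *v x + B *v y))
         + (K *v (y - B *v y - B *v x)) \<bullet> (K *v (y - B *v y - B *v x))
         = (K *v x) \<bullet> (K *v x) + (K *v y) \<bullet> (K *v y)"
  shows "distr (gaussian \<Sigma> \<Otimes>\<^sub>M gaussian \<Sigma>) borel (\<lambda>(x, y). x - B *v x + B *v y) = gaussian \<Sigma>"
proof (rule measure_eqI)
  interpret G: prob_space "gaussian \<Sigma>" by (rule prob_space_gaussian)
  fix S assume "S \<in> sets (distr (gaussian \<Sigma> \<Otimes>\<^sub>M gaussian \<Sigma>) borel (\<lambda>(x, y). x - B *v x + B *v y))"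
  then have S[measurable]: "S \<in> sets borel" by simp
  define R where "R x y = x - B *v x + B *v y" for x y
  define R' where "R' x y = y - B *v y - B *v x" for x y
  have [measurable]: "(\<lambda>(x, y). R x y) \<in> borel \<Otimes>\<^sub>M borel \<rightarrow>\<^sub>M borel"
    "(\<lambda>(x, y). R' x y) \<in> borel \<Otimes>\<^sub>M borel \<rightarrow>\<^sub>M borel" unfolding R_def R'_def split_beta by simp_all
  \<comment> \<open>The product density depends only on |K x|^2 + |K y|^2, which \<open>orth\<close>
    keeps fixed.\<close>
  have gauss_dens_rotate: "gauss_dens (R x y) * gauss_dens (R' x y) = gauss_dens x * gauss_dens y" for x y
  proof -
    have e: "gauss_dens x * gauss_dens y = (\<bar>det K\<bar> / sqrt ((2 * pi) ^ CARD('n)))\<^sup>2 *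
        exp (- ((K *v x) \<bullet> (K *v x) + (K *v y) \<bullet> (K *v y)) / 2)" for x y
      unfolding gauss_dens_def std_gauss_density_eq
      by (simp add: power2_eq_square exp_add[symmetric] field_simps)
    show ?thesis unfolding e unfolding R_def R'_def orth ..
  qed
  define H where "H x y = ennreal (gauss_dens x) * ennreal (gauss_dens y) * indicator S x" for x y
  have Hm[measurable]: "(\<lambda>(x, y). H x y) \<in> borel_measurable (borel \<Otimes>\<^sub>M borel)"
    unfolding H_def by measurable
  have B2: "B *v (B *v x) = B *v x" for x by (simp add: matrix_vector_mul_assoc idem)
  \<comment> \<open>A shear translates one variable by a function of the other, so Fubini and
    translation invariance suffice; no determinant on the product space has to be computed.\<close>
  have shear1: "(\<integral>\<^sup>+x. \<integral>\<^sup>+y. F (x + B *v y) y \<partial>lborel \<partial>lborel) = (\<integral>\<^sup>+x. \<integral>\<^sup>+y. F x y \<partial>lborel \<partial>lborel)"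
    if [measurable]: "(\<lambda>(x, y). F x y) \<in> borel_measurable (borel \<Otimes>\<^sub>M borel)" for F :: "real^'n \<Rightarrow> real^'n \<Rightarrow> ennreal"
  proof -
    have "(\<integral>\<^sup>+x. \<integral>\<^sup>+y. F (x + B *v y) y \<partial>lborel \<partial>lborel) = (\<integral>\<^sup>+y. \<integral>\<^sup>+x. F (x + B *v y) y \<partial>lborel \<partial>lborel)"
      by (rule lborel_pair.Fubini'[symmetric]) measurable
    also have "\<dots> = (\<integral>\<^sup>+y. \<integral>\<^sup>+x. F x y \<partial>lborel \<partial>lborel)"
      by (intro nn_integral_cong nn_integral_lborel_translate) measurable
    also have "\<dots> = (\<integral>\<^sup>+x. \<integral>\<^sup>+y. F x y \<partial>lborel \<partial>lborel)"
      by (rule lborel_pair.Fubini') measurable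
    finally show ?thesis .
  qed
  have shear2: "(\<integral>\<^sup>+x. \<integral>\<^sup>+y. F x (y - B *v x) \<partial>lborel \<partial>lborel) = (\<integral>\<^sup>+x. \<integral>\<^sup>+y. F x y \<partial>lborel \<partial>lborel)"
    if [measurable]: "(\<lambda>(x, y). F x y) \<in> borel_measurable (borel \<Otimes>\<^sub>M borel)" for F :: "real^'n \<Rightarrow> real^'n \<Rightarrow> ennreal"
  proof (rule nn_integral_cong)
    fix x
    have "(\<lambda>y. F x y) \<in> borel_measurable borel" by measurable
    from nn_integral_lborel_translate[OF this, of "- (B *v x)"]
    show "(\<integral>\<^sup>+y. F x (y - B *v x) \<partial>lborel) = (\<integral>\<^sup>+y. F x y \<partial>lborel)" by simp
  qed
  have "(\<integral>\<^sup>+x. \<integral>\<^sup>+y. H x y \<partial>lborel \<partial>lborel) = (\<integral>\<^sup>+x. \<integral>\<^sup>+y. H (x + B *v y) y \<partial>lborel \<partial>lborel)"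
    by (rule shear1[symmetric]) measurable
  also have "\<dots> = (\<integral>\<^sup>+x. \<integral>\<^sup>+y. H (x + B *v (y - B *v x)) (y - B *v x) \<partial>lborel \<partial>lborel)"
    by (rule shear2[symmetric, of "\<lambda>x y. H (x + B *v y) y"]) measurable
  also have "\<dots> = (\<integral>\<^sup>+x. \<integral>\<^sup>+y. H (x + B *v y + B *v (y - B *v (x + B *v y))) (y - B *v (x + B *v y)) \<partial>lborel \<partial>lborel)"
    by (rule shear1[symmetric, of "\<lambda>x y. H (x + B *v (y - B *v x)) (y - B *v x)"]) measurable
  also have "\<dots> = (\<integral>\<^sup>+x. \<integral>\<^sup>+y. H (R x y) (R' x y) \<partial>lborel \<partial>lborel)"
    \<comment> \<open>Here B^2 = B makes the composed shears collapse: x + B y + B (y - B (x + B y))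
      = x - B x + B y.\<close>
    by (simp add: R_def R'_def matrix_vector_right_distrib matrix_vector_mult_diff_distrib B2 algebra_simps)
  also have "\<dots> = (\<integral>\<^sup>+x. \<integral>\<^sup>+y. ennreal (gauss_dens x) * ennreal (gauss_dens y) * indicator S (R x y) \<partial>lborel \<partial>lborel)"
    unfolding H_def by (simp add: ennreal_mult[symmetric] gauss_dens_nonneg gauss_dens_rotate)
  finally have eq: "(\<integral>\<^sup>+x. \<integral>\<^sup>+y. H x y \<partial>lborel \<partial>lborel) =
    (\<integral>\<^sup>+x. \<integral>\<^sup>+y. ennreal (gauss_dens x) * ennreal (gauss_dens y) * indicator S (R x y) \<partial>lborel \<partial>lborel)" .
  have dens: "(\<integral>\<^sup>+x. \<integral>\<^sup>+y. F x y \<partial>gaussian \<Sigma> \<partial>gaussian \<Sigma>) =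
      (\<integral>\<^sup>+x. \<integral>\<^sup>+y. ennreal (gauss_dens x) * ennreal (gauss_dens y) * F x y \<partial>lborel \<partial>lborel)"
    if [measurable]: "(\<lambda>(x, y). F x y) \<in> borel_measurable (borel \<Otimes>\<^sub>M borel)" for F :: "real^'n \<Rightarrow> real^'n \<Rightarrow> ennreal"
    unfolding gaussian_eq
    by (subst nn_integral_density, measurable, subst nn_integral_density, measurable)
       (auto intro!: nn_integral_cong simp: mult.assoc nn_integral_cmult)
  have "emeasure (distr (gaussian \<Sigma> \<Otimes>\<^sub>M gaussian \<Sigma>) borel (\<lambda>(x, y). R x y)) S =
     (\<integral>\<^sup>+u. indicator S u \<partial>distr (gaussian \<Sigma> \<Otimes>\<^sub>M gaussian \<Sigma>) borel (\<lambda>(x, y). R x y))"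
    by simp
  also have "\<dots> = (\<integral>\<^sup>+z. indicator S (case z of (x, y) \<Rightarrow> R x y) \<partial>(gaussian \<Sigma> \<Otimes>\<^sub>M gaussian \<Sigma>))"
    by (rule nn_integral_distr) simp_all
  also have "\<dots> = (\<integral>\<^sup>+x. \<integral>\<^sup>+y. indicator S (R x y) \<partial>gaussian \<Sigma> \<partial>gaussian \<Sigma>)"
    by (subst G.nn_integral_fst[symmetric]) auto
  also have "\<dots> = (\<integral>\<^sup>+x. \<integral>\<^sup>+y. indicator S x \<partial>gaussian \<Sigma> \<partial>gaussian \<Sigma>)"
    by (subst (1 2) dens) (auto simp: eq[symmetric] H_def)
  also have "\<dots> = emeasure (gaussian \<Sigma>) S"
    using G.emeasure_space_1 by simp
  finally show "emeasure (distr (gaussian \<Sigma> \<Otimes>\<^sub>M gaussian \<Sigma>) borel (\<lambda>(x, y). x - B *v x + B *v y)) S = emeasure (gaussian \<Sigma>) S"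
    by (simp add: R_def)
qed simp

end

section \<open>Density of trigonometric polynomials\<close>

text \<open>Entries are (coefficient, frequency, phase). The phase covers sines as well and makes a
  product of two terms a sum of two such terms; lists make addition a concatenation, with repeated
  frequencies harmless.\<close>

definition trig_poly :: "(real \<times> 'a \<times> real) list \<Rightarrow> 'a::real_inner \<Rightarrow> real" where
  "trig_poly xs x = (\<Sum>(c, a, \<theta>)\<leftarrow>xs. c * cos (a \<bullet> x + \<theta>))"

lemma trig_poly_simps[simp]:
  "trig_poly [] x = 0"
  "trig_poly ((c, a, \<theta>) # xs) x = c * cos (a \<bullet> x + \<theta>) + trig_poly xs x"
  "trig_poly (xs @ ys) x = trig_poly xs x + trig_poly ys x"
  by (simp_all add: trig_poly_def)

lemma trig_poly_bounded: "\<bar>trig_poly xs x\<bar> \<le> (\<Sum>(c, a, \<theta>)\<leftarrow>xs. \<bar>c\<bar>)"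
proof (induction xs)
  case (Cons z xs)
  obtain c a \<theta> where z: "z = (c, a, \<theta>)" by (cases z)
  have "\<bar>c * cos (a \<bullet> x + \<theta>)\<bar> \<le> \<bar>c\<bar>" by (simp add: abs_mult mult_left_le)
  then show ?case using Cons by (simp add: z)
qed simp

lemma continuous_on_trig_poly: "continuous_on S (trig_poly xs)"
proof (induction xs)
  case (Cons z xs)
  obtain c a \<theta> where z: "z = (c, a, \<theta>)" by (cases z)
  have "trig_poly (z # xs) = (\<lambda>x. c * cos (a \<bullet> x + \<theta>) + trig_poly xs x)" by (auto simp: z)
  then show ?case using Cons by (auto intro!: continuous_intros)
qed (simp add: trig_poly_def[abs_def])

lemma borel_measurable_trig_poly[measurable]:
  "trig_poly xs \<in> borel_measurable borel"
  by (intro borel_measurable_continuous_onI continuous_on_trig_poly)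

lemma trig_poly_mult_ex: "\<exists>zs. \<forall>x. trig_poly zs x = trig_poly xs x * trig_poly ys x"
proof (induction xs)
  case Nil
  show ?case by (rule exI[of _ "[]"]) simp
next
  case (Cons z xs)
  obtain c a \<theta> where z: "z = (c, a, \<theta>)" by (cases z)
  have "\<exists>zs. \<forall>x. trig_poly zs x = c * cos (a \<bullet> x + \<theta>) * trig_poly ys x"
  proof (induction ys)
    case Nil
    show ?case by (rule exI[of _ "[]"]) simp
  next
    case (Cons y ys)
    then obtain zs where zs: "\<And>x. trig_poly zs x = c * cos (a \<bullet> x + \<theta>) * trig_poly ys x" by blast
    obtain d b \<phi> where y: "y = (d, b, \<phi>)" by (cases y)
    have "trig_poly ((c * d / 2, a - b, \<theta> - \<phi>) # (c * d / 2, a + b, \<theta> + \<phi>) # zs) x =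
        c * cos (a \<bullet> x + \<theta>) * trig_poly (y # ys) x" for x
    proof -
      have "cos (a \<bullet> x + \<theta>) * cos (b \<bullet> x + \<phi>) =
          (cos ((a - b) \<bullet> x + (\<theta> - \<phi>)) + cos ((a + b) \<bullet> x + (\<theta> + \<phi>))) / 2"
      proof -
        have "(a - b) \<bullet> x + (\<theta> - \<phi>) = a \<bullet> x + \<theta> - (b \<bullet> x + \<phi>)"
          "(a + b) \<bullet> x + (\<theta> + \<phi>) = a \<bullet> x + \<theta> + (b \<bullet> x + \<phi>)"
          by (simp_all add: inner_diff_left inner_add_left)
        then show ?thesis by (simp only: cos_times_cos)
      qed
      moreover have "c * d / 2 * U + (c * d / 2 * V + c * X * T) = c * X * (d * Y + T)"
        if "X * Y = (U + V) / 2" for X Y U V T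
        using that by algebra
      ultimately show ?thesis by (simp only: y zs trig_poly_simps)
    qed
    then show ?case by blast
  qed
  then obtain us where us: "\<And>x. trig_poly us x = c * cos (a \<bullet> x + \<theta>) * trig_poly ys x" by blast
  obtain vs where vs: "\<And>x. trig_poly vs x = trig_poly xs x * trig_poly ys x" using Cons by blast
  have "trig_poly (us @ vs) x = trig_poly (z # xs) x * trig_poly ys x" for x
    by (simp add: z us vs algebra_simps)
  then show ?case by blast
qed

lemma trig_poly_const: "trig_poly [(c, 0, 0)] x = c"
  by simp

lemma trig_poly_separates:
  fixes x y :: "'a::real_inner"
  assumes "x \<noteq> y"
  shows "\<exists>xs. trig_poly xs x \<noteq> trig_poly xs y"
proof -
  \<comment> \<open>Scaled so that \<open>a \<bullet> (x - y)\<close> is a quarter period: the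
    cosine with phase \<open>- (a \<bullet> y)\<close> is 0 at \<open>x\<close> and 1 at
    \<open>y\<close>.\<close>
  define a where "a = (pi / (2 * ((x - y) \<bullet> (x - y)))) *\<^sub>R (x - y)"
  have "(x - y) \<bullet> (x - y) \<noteq> 0" using assms by simp
  then have a: "a \<bullet> (x - y) = pi / 2" by (simp add: a_def)
  have "trig_poly [(1, a, - (a \<bullet> y))] x = cos (a \<bullet> (x - y))" by (simp add: inner_diff_right)
  moreover have "trig_poly [(1, a, - (a \<bullet> y))] y = 1" by simp
  ultimately show ?thesis using a by (intro exI[of _ "[(1, a, - (a \<bullet> y))]"]) simp
qed

lemma trig_poly_compose_polynomial:
  assumes "real_polynomial_function (q :: real \<Rightarrow> real)"
  shows "\<exists>zs. \<forall>x. trig_poly zs x = q (trig_poly xs x)"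
  using assms
proof induction
  case (linear f)
  have f: "f y = f 1 * y" for y
    using linear_cmul[OF bounded_linear.linear[OF linear], of y 1] by simp
  obtain zs where "\<And>x. trig_poly zs x = trig_poly [(f 1, 0, 0)] x * trig_poly xs x"
    using trig_poly_mult_ex by metis
  then have "trig_poly zs x = f (trig_poly xs x)" for x
    by (subst f) simp
  then show ?case by blast
next
  case (const c)
  show ?case using trig_poly_const by blast
next
  case (add f g)
  then obtain us vs where "\<And>x. trig_poly us x = f (trig_poly xs x)" "\<And>x. trig_poly vs x = g (trig_poly xs x)"
    by blast
  then have "trig_poly (us @ vs) x = f (trig_poly xs x) + g (trig_poly xs x)" for x by simp
  then show ?case by blast
next
  case (mult f g)
  then obtain us vs where "\<And>x. trig_poly us x = f (trig_poly xs x)" "\<And>x. trig_poly vs x = g (trig_poly xs x)"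
    by blast
  then show ?case using trig_poly_mult_ex[of us vs] by simp
qed

text \<open>Composing a Stone-Weierstrass approximation on S with a polynomial close to a clamp
  function gives an approximation on S that is bounded everywhere.\<close>

lemma trig_poly_approx_bounded:
  fixes g :: "'a::euclidean_space \<Rightarrow> real"
  assumes S: "compact S" and g: "continuous_on S g" and bd: "\<And>x. x \<in> S \<Longrightarrow> \<bar>g x\<bar> \<le> M"
    and M: "M \<ge> 0" and e: "e > 0"
  shows "\<exists>xs. (\<forall>x\<in>S. \<bar>g x - trig_poly xs x\<bar> < e) \<and> (\<forall>x. \<bar>trig_poly xs x\<bar> \<le> M + e)"
proof -
  interpret function_ring_on "range trig_poly" S
  proof
    fix f h :: "'a \<Rightarrow> real" assume "f \<in> range trig_poly" "h \<in> range trig_poly"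
    then obtain us vs where fh: "f = trig_poly us" "h = trig_poly vs" by auto
    have "(\<lambda>x. f x + h x) = trig_poly (us @ vs)" by (auto simp: fh)
    then show "(\<lambda>x. f x + h x) \<in> range trig_poly" by blast
    obtain zs where "\<And>x. trig_poly zs x = trig_poly us x * trig_poly vs x"
      using trig_poly_mult_ex by blast
    then have "(\<lambda>x. f x * h x) = trig_poly zs" by (auto simp: fh)
    then show "(\<lambda>x. f x * h x) \<in> range trig_poly" by blast
  next
    fix c :: real
    have "(\<lambda>_. c) = trig_poly [(c, 0 :: 'a, 0)]" by auto
    then show "(\<lambda>_. c) \<in> range (trig_poly :: _ \<Rightarrow> 'a \<Rightarrow> real)" by blast
  next
    fix x y :: 'a assume "x \<noteq> y"
    then show "\<exists>f\<in>range trig_poly. f x \<noteq> f y" using trig_poly_separates by blast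
  qed (auto intro: S continuous_on_trig_poly)
  obtain hs where hs: "\<And>x. x \<in> S \<Longrightarrow> \<bar>g x - trig_poly hs x\<bar> < e / 2"
    using Stone_Weierstrass_basic[OF g, of "e / 2"] e by auto
  define H where "H = (\<Sum>(c, a, \<theta>)\<leftarrow>hs. \<bar>c\<bar>)"
  have H: "trig_poly hs x \<in> {- H..H}" for x
    using trig_poly_bounded[of hs x] by (simp add: H_def abs_le_iff)
  \<comment> \<open>The clamp to [-M, M] is 1-Lipschitz and fixes the values of \<open>g\<close> on
    \<open>S\<close>, so it does not increase the error of \<open>hs\<close> there. The two errors
    e/2 come from \<open>hs\<close> and from replacing the clamp by a polynomial.\<close>
  define \<kappa> where "\<kappa> y = max (- M) (min M y)" for y :: real
  have "continuous_on {- H..H} \<kappa>" unfolding \<kappa>_def by (intro continuous_intros)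
  then obtain q where q: "real_polynomial_function q" "\<And>y. y \<in> {- H..H} \<Longrightarrow> \<bar>\<kappa> y - q y\<bar> < e / 2"
    using Stone_Weierstrass_real_polynomial_function[OF compact_Icc _, of "- H" H \<kappa> "e / 2"] e by auto
  obtain xs where xs: "\<And>x. trig_poly xs x = q (trig_poly hs x)"
    using trig_poly_compose_polynomial[OF q(1)] by blast
  have q': "\<bar>\<kappa> (trig_poly hs x) - trig_poly xs x\<bar> < e / 2" for x
    using q(2)[OF H] by (simp add: xs)
  have "\<bar>g x - trig_poly xs x\<bar> < e" if "x \<in> S" for x
  proof -
    have "\<kappa> (g x) = g x" using bd[OF that] by (simp add: \<kappa>_def abs_le_iff)
    moreover have "\<bar>\<kappa> (g x) - \<kappa> (trig_poly hs x)\<bar> \<le> \<bar>g x - trig_poly hs x\<bar>"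
      unfolding \<kappa>_def by linarith
    ultimately show ?thesis using hs[OF that] q'[of x] by linarith
  qed
  moreover have "\<bar>trig_poly xs x\<bar> \<le> M + e" for x
  proof -
    have "\<bar>\<kappa> (trig_poly hs x)\<bar> \<le> M" using M unfolding \<kappa>_def by linarith
    then show ?thesis using q'[of x] e by linarith
  qed
  ultimately show ?thesis by blast
qed

text \<open>A measurable function is almost everywhere a limit of continuous ones. The n-th of
  these, clamped, is approximated within 1/(n+1) on the ball of radius n, which eventually contains
  any given point. The bound uniform in \<open>n\<close> and \<open>x\<close> is what dominated
  convergence will need.\<close>

lemma trig_poly_approx_AE:
  fixes f :: "'a::euclidean_space \<Rightarrow> real"
  assumes f[measurable]: "f \<in> borel_measurable borel" and bd: "\<And>x. \<bar>f x\<bar> \<le> M"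
  shows "\<exists>t. (\<forall>n x. \<bar>trig_poly (t n) x\<bar> \<le> M + 1) \<and> (AE x in lborel. (\<lambda>n. trig_poly (t n) x) \<longlonglongrightarrow> f x)"
proof -
  have M: "M \<ge> 0" using bd[of undefined] by linarith
  \<comment> \<open>The shift by \<open>M\<close> produces a nonnegative function, as the
    approximation theorem requires; \<open>g'\<close> below undoes the shift and clamps, which
    leaves the limit in place because \<open>f\<close> takes values in [-M, M].\<close>
  have "(\<lambda>x. f x + M) \<in> borel_measurable lebesgue"
    by (rule measurable_completion) simp
  moreover have "f x + M \<ge> 0" for x using bd[of x] by linarith
  ultimately have "(\<lambda>x. f x + M) measurable_on UNIV"
    by (rule lebesgue_measurable_imp_measurable_on_nnreal_UNIV)
  then obtain N g where N: "negligible N" and g: "\<And>n. continuous_on UNIV (g n)"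
    and lim: "\<And>x. x \<notin> N \<Longrightarrow> (\<lambda>n. g n x) \<longlonglongrightarrow> f x + M"
    unfolding measurable_on_def by auto
  define g' where "g' n x = max (- M) (min M (g n x - M))" for n :: nat and x
  have g': "continuous_on S (g' n)" for S n
    unfolding g'_def by (intro continuous_intros continuous_on_subset[OF g]) auto
  have bd': "\<bar>g' n x\<bar> \<le> M" for n x using M by (auto simp: g'_def abs_if max_def min_def)
  have lim': "(\<lambda>n. g' n x) \<longlonglongrightarrow> f x" if "x \<notin> N" for x
  proof -
    have "(\<lambda>n. g n x - M) \<longlonglongrightarrow> f x + M - M"
      by (intro tendsto_diff lim that tendsto_const)
    then have "(\<lambda>n. g' n x) \<longlonglongrightarrow> max (- M) (min M (f x))"
      unfolding g'_def by (intro tendsto_max tendsto_min tendsto_const) simp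
    also have "max (- M) (min M (f x)) = f x" using bd[of x] by (auto simp: abs_le_iff)
    finally show ?thesis .
  qed
  have "\<exists>xs. (\<forall>x\<in>cball 0 (real n). \<bar>g' n x - trig_poly xs x\<bar> < 1 / Suc n) \<and>
      (\<forall>x. \<bar>trig_poly xs x\<bar> \<le> M + 1 / Suc n)" for n
    by (rule trig_poly_approx_bounded) (use g' bd' M in auto)
  then obtain t where t: "\<And>n x. x \<in> cball 0 (real n) \<Longrightarrow> \<bar>g' n x - trig_poly (t n) x\<bar> < 1 / Suc n"
    and tb: "\<And>n x. \<bar>trig_poly (t n) x\<bar> \<le> M + 1 / Suc n"
    by metis
  have "\<bar>trig_poly (t n) x\<bar> \<le> M + 1" for n x
  proof -
    have "1 / real (Suc n) \<le> 1" by simp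
    then show ?thesis using tb[of n x] by linarith
  qed
  moreover have "(\<lambda>n. trig_poly (t n) x) \<longlonglongrightarrow> f x" if "x \<notin> N" for x
  proof -
    have "eventually (\<lambda>n. \<bar>g' n x - trig_poly (t n) x\<bar> \<le> 1 / Suc n) sequentially"
    proof -
      obtain m where "norm x \<le> real m" using real_arch_simple by blast
      then show ?thesis
        by (intro eventually_sequentiallyI[of m] less_imp_le[OF t]) simp
    qed
    moreover have "(\<lambda>n. 1 / real (Suc n)) \<longlonglongrightarrow> 0"
      using LIMSEQ_inverse_real_of_nat by (simp add: inverse_eq_divide)
    ultimately have "(\<lambda>n. g' n x - trig_poly (t n) x) \<longlonglongrightarrow> 0"
      unfolding real_norm_def[symmetric] by (rule Lim_null_comparison)
    from tendsto_diff[OF lim'[OF that] this] show ?thesis by simp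
  qed
  moreover have "AE x in lborel. x \<notin> N"
  proof -
    obtain N' where "N' \<in> null_sets lborel" "N \<subseteq> N'"
      using N null_sets_completion_iff2[of N lborel] by (auto simp: negligible_iff_null_sets)
    then show ?thesis using AE_not_in[of N' lborel] by (auto elim: eventually_mono)
  qed
  ultimately show ?thesis by (intro exI[of _ t]) auto
qed

section \<open>Schur products of Gram kernels\<close>

definition psd_kernel :: "'j set \<Rightarrow> ('j \<Rightarrow> 'j \<Rightarrow> real) \<Rightarrow> bool" where
  "psd_kernel J M \<longleftrightarrow> (\<forall>w. 0 \<le> (\<Sum>j\<in>J. \<Sum>l\<in>J. w j * w l * M j l))"

lemma psd_kernel_add:
  "psd_kernel J M \<Longrightarrow> psd_kernel J N \<Longrightarrow> psd_kernel J (\<lambda>j l. M j l + N j l)"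
  unfolding psd_kernel_def by (simp add: distrib_left sum.distrib)

lemma psd_kernel_cmult:
  assumes "psd_kernel J M" "0 \<le> c"
  shows "psd_kernel J (\<lambda>j l. c * M j l)"
  unfolding psd_kernel_def
proof
  fix w
  have "(\<Sum>j\<in>J. \<Sum>l\<in>J. w j * w l * (c * M j l)) = c * (\<Sum>j\<in>J. \<Sum>l\<in>J. w j * w l * M j l)"
    by (simp add: sum_distrib_left mult_ac)
  then show "0 \<le> (\<Sum>j\<in>J. \<Sum>l\<in>J. w j * w l * (c * M j l))"
    using assms by (simp add: psd_kernel_def)
qed

lemma psd_kernel_zero: "psd_kernel J (\<lambda>j l. 0)"
  by (simp add: psd_kernel_def)

lemma psd_kernel_sum:
  assumes "\<And>i. i \<in> I \<Longrightarrow> psd_kernel J (M i)"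
  shows "psd_kernel J (\<lambda>j l. \<Sum>i\<in>I. M i j l)"
  using assms by (induction I rule: infinite_finite_induct) (auto intro: psd_kernel_zero psd_kernel_add)

text \<open>Schur product theorem for a Gram factor: expanded in an orthonormal basis, the factor is
  a sum of rank one kernels, and a rank one kernel can be absorbed into the weights
  \<open>w\<close>.\<close>

lemma psd_kernel_mult_gram:
  fixes u :: "'j \<Rightarrow> 'a::euclidean_space"
  assumes M: "psd_kernel J M"
  shows "psd_kernel J (\<lambda>j l. M j l * (u j \<bullet> u l))"
proof -
  have "psd_kernel J (\<lambda>j l. M j l * ((u j \<bullet> b) * (u l \<bullet> b)))" for b
    unfolding psd_kernel_def
  proof
    fix w
    have "0 \<le> (\<Sum>j\<in>J. \<Sum>l\<in>J. (w j * (u j \<bullet> b)) * (w l * (u l \<bullet> b)) * M j l)"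
      using M by (simp add: psd_kernel_def)
    then show "0 \<le> (\<Sum>j\<in>J. \<Sum>l\<in>J. w j * w l * (M j l * ((u j \<bullet> b) * (u l \<bullet> b))))"
      by (simp add: mult_ac)
  qed
  then have "psd_kernel J (\<lambda>j l. \<Sum>b\<in>Basis. M j l * ((u j \<bullet> b) * (u l \<bullet> b)))"
    by (rule psd_kernel_sum)
  then show ?thesis by (subst (1) euclidean_inner) (simp add: sum_distrib_left)
qed

lemma psd_kernel_one: "psd_kernel J (\<lambda>j l. 1)"
proof -
  have "(\<Sum>j\<in>J. \<Sum>l\<in>J. w j * w l) = (sum w J)\<^sup>2" for w :: "'a \<Rightarrow> real"
    by (simp add: power2_eq_square sum_product)
  then show ?thesis by (simp add: psd_kernel_def)
qed

lemma psd_kernel_mult_gram_power: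
  fixes u :: "'j \<Rightarrow> 'a::euclidean_space"
  assumes "psd_kernel J M"
  shows "psd_kernel J (\<lambda>j l. M j l * (u j \<bullet> u l) ^ k)"
proof (induction k)
  case (Suc k)
  from psd_kernel_mult_gram[OF this, of u] show ?case by (simp add: mult_ac)
qed (use assms in simp)

lemma psd_kernel_gram_power:
  fixes u :: "'j \<Rightarrow> 'a::euclidean_space"
  shows "psd_kernel J (\<lambda>j l. (u j \<bullet> u l) ^ k)"
  using psd_kernel_mult_gram_power[OF psd_kernel_one, of J u k] by simp

text \<open>\<open>P_proj\<close> encodes orthogonal projections in one equation: P^T P = P says
  that P is symmetric and idempotent.\<close>

locale projection_average =
  fixes I :: "'i set" and p :: "'i \<Rightarrow> real" and P :: "'i \<Rightarrow> 'a::euclidean_space \<Rightarrow> 'a" and c :: real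
  assumes p_nonneg: "\<And>i. i \<in> I \<Longrightarrow> 0 \<le> p i"
    and P_linear: "\<And>i. i \<in> I \<Longrightarrow> linear (P i)"
    and P_proj: "\<And>i x y. i \<in> I \<Longrightarrow> x \<bullet> P i y = P i x \<bullet> P i y"
    and P_bound: "\<And>x. (\<Sum>i\<in>I. p i * (x \<bullet> P i x)) \<le> c * (x \<bullet> x)"
begin

lemma psd_base:
  "psd_kernel J (\<lambda>j l. c * (a j \<bullet> a l) - (\<Sum>i\<in>I. p i * (a j \<bullet> P i (a l))))"
  unfolding psd_kernel_def
proof
  fix w
  define v where "v = (\<Sum>j\<in>J. w j *\<^sub>R a j)"
  have "(\<Sum>j\<in>J. \<Sum>l\<in>J. w j * w l * (a j \<bullet> a l)) = v \<bullet> v"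
    unfolding v_def inner_sum_left by (simp add: inner_sum_right sum_distrib_left mult_ac)
  moreover have "(\<Sum>j\<in>J. \<Sum>l\<in>J. w j * w l * (a j \<bullet> P i (a l))) = v \<bullet> P i v" if "i \<in> I" for i
  proof -
    have Pv: "P i v = (\<Sum>l\<in>J. w l *\<^sub>R P i (a l))"
      unfolding v_def by (simp add: linear_sum[OF P_linear[OF that]] linear_cmul[OF P_linear[OF that]])
    have "v \<bullet> P i v = (\<Sum>j\<in>J. w j * (a j \<bullet> P i v))"
      by (subst v_def) (simp add: inner_sum_left)
    also have "\<dots> = (\<Sum>j\<in>J. \<Sum>l\<in>J. w j * w l * (a j \<bullet> P i (a l)))"
      unfolding Pv by (simp add: inner_sum_right sum_distrib_left mult_ac)
    finally show ?thesis by simp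
  qed
  moreover have "(\<Sum>j\<in>J. \<Sum>l\<in>J. w j * w l * (c * (a j \<bullet> a l) - (\<Sum>i\<in>I. p i * (a j \<bullet> P i (a l))))) =
      c * (\<Sum>j\<in>J. \<Sum>l\<in>J. w j * w l * (a j \<bullet> a l)) -
      (\<Sum>i\<in>I. p i * (\<Sum>j\<in>J. \<Sum>l\<in>J. w j * w l * (a j \<bullet> P i (a l))))"
  proof -
    have "(\<Sum>i\<in>I. p i * (\<Sum>j\<in>J. \<Sum>l\<in>J. w j * w l * (a j \<bullet> P i (a l)))) =
        (\<Sum>j\<in>J. \<Sum>l\<in>J. w j * w l * (\<Sum>i\<in>I. p i * (a j \<bullet> P i (a l))))"
      unfolding sum_distrib_left
      by (subst sum.swap, intro sum.cong refl, subst sum.swap) (simp add: mult_ac)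
    then show ?thesis
      by (simp add: right_diff_distrib sum_subtractf sum_distrib_left mult_ac)
  qed
  ultimately show "0 \<le> (\<Sum>j\<in>J. \<Sum>l\<in>J. w j * w l * (c * (a j \<bullet> a l) - (\<Sum>i\<in>I. p i * (a j \<bullet> P i (a l)))))"
    using P_bound[of v] by simp
qed

text \<open>With g and h the Gram kernels of \<open>a j\<close> and of \<open>P i (a j)\<close>, the
  induction rests on h g^(k+1) - h^(k+2) = (h g^k - h^(k+1)) g + h^(k+1) (g - h), where g - h is
  again a Gram kernel, that of the complementary projection.\<close>

lemma psd_diff:
  assumes i: "i \<in> I"
  shows "psd_kernel J (\<lambda>j l. (a j \<bullet> P i (a l)) * (a j \<bullet> a l) ^ k - (a j \<bullet> P i (a l)) ^ Suc k)"
proof (induction k)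
  case 0
  show ?case by (simp add: psd_kernel_zero)
next
  case (Suc k)
  have h: "x \<bullet> P i y = P i x \<bullet> P i y" for x y by (rule P_proj[OF i])
  have gh: "x \<bullet> y - x \<bullet> P i y = (x - P i x) \<bullet> (y - P i y)" for x y
    using h[of x y] h[of y x] by (simp add: inner_diff_left inner_diff_right inner_commute)
  have 1: "psd_kernel J (\<lambda>j l. ((a j \<bullet> P i (a l)) * (a j \<bullet> a l) ^ k - (a j \<bullet> P i (a l)) ^ Suc k) * (a j \<bullet> a l))"
    by (rule psd_kernel_mult_gram[OF Suc])
  have 2: "psd_kernel J (\<lambda>j l. (a j \<bullet> P i (a l)) ^ Suc k * (a j \<bullet> a l - a j \<bullet> P i (a l)))"
    unfolding gh by (rule psd_kernel_mult_gram) (rule psd_kernel_gram_power[of J "\<lambda>j. P i (a j)" "Suc k", folded h])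
  have "((a j \<bullet> P i (a l)) * (a j \<bullet> a l) ^ k - (a j \<bullet> P i (a l)) ^ Suc k) * (a j \<bullet> a l) +
      (a j \<bullet> P i (a l)) ^ Suc k * (a j \<bullet> a l - a j \<bullet> P i (a l)) =
      (a j \<bullet> P i (a l)) * (a j \<bullet> a l) ^ Suc k - (a j \<bullet> P i (a l)) ^ Suc (Suc k)" for j l
    by (simp add: algebra_simps)
  with psd_kernel_add[OF 1 2] show ?case by (simp only:)
qed

text \<open>Splits as (c g - sum_i p_i h_i) g^k + sum_i p_i (h_i g^k - h_i^(k+1)), both summands
  being positive semidefinite. The exponent starts at 1: in degree 0 the claim would amount to sum_i
  p_i <= c.\<close>

lemma psd_power:
  "psd_kernel J (\<lambda>j l. c * (a j \<bullet> a l) ^ Suc k - (\<Sum>i\<in>I. p i * (a j \<bullet> P i (a l)) ^ Suc k))"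
proof -
  have 1: "psd_kernel J (\<lambda>j l. (c * (a j \<bullet> a l) - (\<Sum>i\<in>I. p i * (a j \<bullet> P i (a l)))) * (a j \<bullet> a l) ^ k)"
    by (rule psd_kernel_mult_gram_power[OF psd_base])
  have 2: "psd_kernel J (\<lambda>j l. \<Sum>i\<in>I. p i * ((a j \<bullet> P i (a l)) * (a j \<bullet> a l) ^ k - (a j \<bullet> P i (a l)) ^ Suc k))"
    by (intro psd_kernel_sum psd_kernel_cmult psd_diff p_nonneg)
  have "(c * (a j \<bullet> a l) - (\<Sum>i\<in>I. p i * (a j \<bullet> P i (a l)))) * (a j \<bullet> a l) ^ k +
      (\<Sum>i\<in>I. p i * ((a j \<bullet> P i (a l)) * (a j \<bullet> a l) ^ k - (a j \<bullet> P i (a l)) ^ Suc k)) =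
      c * (a j \<bullet> a l) ^ Suc k - (\<Sum>i\<in>I. p i * (a j \<bullet> P i (a l)) ^ Suc k)" for j l
    by (simp add: left_diff_distrib right_diff_distrib sum_subtractf sum_distrib_right sum_distrib_left mult_ac)
  with psd_kernel_add[OF 1 2] show ?thesis by simp
qed

end

text \<open>For standard Gaussian u, the expectation of cos(a.u + \<theta>) cos(b.u + \<phi>) is
  exp(-(|a|^2 + |b|^2)/2) times this kernel at t = a.b; see \<open>integral_cos_cos\<close>.\<close>

definition cos_kernel :: "real \<Rightarrow> real \<Rightarrow> real \<Rightarrow> real" where
  "cos_kernel t \<theta> \<phi> = (exp t * cos (\<theta> - \<phi>) + exp (- t) * cos (\<theta> + \<phi>)) / 2"

lemma cos_kernel_0: "cos_kernel 0 \<theta> \<phi> = cos \<theta> * cos \<phi>"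
  by (simp add: cos_kernel_def cos_diff cos_add)

text \<open>The degree k coefficient of \<open>cos_kernel\<close> is (cos(\<theta> - \<phi>) +
  (-1)^k cos(\<theta> + \<phi>))/2, which is cos cos or sin sin according to parity. Being a product
  of a function of \<theta> and the same function of \<phi>, it can be absorbed into
  weights.\<close>

definition phase :: "nat \<Rightarrow> real \<Rightarrow> real" where
  "phase k \<theta> = (if even k then cos \<theta> else sin \<theta>)"

lemma cos_kernel_sums:
  "(\<lambda>k. t ^ k / fact k * (phase k \<theta> * phase k \<phi>)) sums cos_kernel t \<theta> \<phi>"
proof -
  have e: "(\<lambda>k. t ^ k / fact k) sums exp t" for t :: real
    using exp_converges[of t] by (simp add: divide_inverse mult.commute)
  have "(\<lambda>k. (t ^ k / fact k * cos (\<theta> - \<phi>) + (- t) ^ k / fact k * cos (\<theta> + \<phi>)) / 2) sums cos_kernel t \<theta> \<phi>"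
    unfolding cos_kernel_def by (intro sums_divide sums_add sums_mult2 e)
  moreover have "(t ^ k / fact k * cos (\<theta> - \<phi>) + (- t) ^ k / fact k * cos (\<theta> + \<phi>)) / 2 =
      t ^ k / fact k * (phase k \<theta> * phase k \<phi>)" for k
    by (cases "even k") (simp_all add: phase_def cos_diff cos_add field_simps)
  ultimately show ?thesis by simp
qed

lemma cos_kernel_sums_tail:
  "(\<lambda>k. t ^ Suc k / fact (Suc k) * (phase (Suc k) \<theta> * phase (Suc k) \<phi>)) sums
     (cos_kernel t \<theta> \<phi> - cos_kernel 0 \<theta> \<phi>)"
  using cos_kernel_sums[of t \<theta> \<phi>] unfolding sums_Suc_iff[symmetric] cos_kernel_0
  by (subst sums_Suc_iff) (simp add: phase_def)

lemma (in projection_average) cos_kernel_bound: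
  fixes a :: "'j \<Rightarrow> 'a" and d \<theta> :: "'j \<Rightarrow> real"
  assumes "finite J"
  shows "(\<Sum>j\<in>J. \<Sum>l\<in>J. d j * d l * (\<Sum>i\<in>I. p i * (cos_kernel (a j \<bullet> P i (a l)) (\<theta> j) (\<theta> l) - cos_kernel 0 (\<theta> j) (\<theta> l))))
    \<le> (\<Sum>j\<in>J. \<Sum>l\<in>J. d j * d l * (c * (cos_kernel (a j \<bullet> a l) (\<theta> j) (\<theta> l) - cos_kernel 0 (\<theta> j) (\<theta> l))))"
    (is "?L \<le> ?R")
proof -
  define L where "L k = (\<Sum>j\<in>J. \<Sum>l\<in>J. d j * d l * (\<Sum>i\<in>I. p i *
     ((a j \<bullet> P i (a l)) ^ Suc k / fact (Suc k) * (phase (Suc k) (\<theta> j) * phase (Suc k) (\<theta> l)))))" for k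
  define R where "R k = (\<Sum>j\<in>J. \<Sum>l\<in>J. d j * d l * (c *
     ((a j \<bullet> a l) ^ Suc k / fact (Suc k) * (phase (Suc k) (\<theta> j) * phase (Suc k) (\<theta> l)))))" for k
  have "L sums ?L" unfolding L_def by (intro sums_sum sums_mult cos_kernel_sums_tail)
  moreover have "R sums ?R" unfolding R_def by (intro sums_sum sums_mult cos_kernel_sums_tail)
  moreover have "L k \<le> R k" for k
  proof -
    \<comment> \<open>Coefficient and phase together form the weight vector at which
      \<open>psd_power\<close> is evaluated in degree k + 1.\<close>
    define w where "w j = d j * phase (Suc k) (\<theta> j)" for j
    have "R k - L k = (\<Sum>j\<in>J. \<Sum>l\<in>J. w j * w l * (c * (a j \<bullet> a l) ^ Suc k - (\<Sum>i\<in>I. p i * (a j \<bullet> P i (a l)) ^ Suc k))) / fact (Suc k)"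
      unfolding R_def L_def sum_subtractf[symmetric] sum_divide_distrib
      by (intro sum.cong refl)
         (simp del: power_Suc fact_Suc add: w_def right_diff_distrib diff_divide_distrib sum_distrib_left sum_divide_distrib mult_ac)
    also have "\<dots> \<ge> 0"
      using psd_power[of J a k] unfolding psd_kernel_def by (intro divide_nonneg_nonneg) auto
    finally show ?thesis by simp
  qed
  ultimately show ?thesis by (meson sums_le)
qed

section \<open>Mixtures of conditional expectations\<close>

lemma L2_funD:
  assumes "L2_fun M f"
  shows "f \<in> borel_measurable M" "integrable M (\<lambda>x. (f x)\<^sup>2)"
  using assms by (auto simp: L2_fun_def)

lemma L2_fun_mult_integrable:
  assumes "L2_fun M f" "L2_fun M g"
  shows "integrable M (\<lambda>x. f x * g x)"
proof (rule Bochner_Integration.integrable_bound)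
  show "integrable M (\<lambda>x. (f x)\<^sup>2 + (g x)\<^sup>2)" using assms by (auto simp: L2_fun_def)
  show "(\<lambda>x. f x * g x) \<in> borel_measurable M" using assms by (auto simp: L2_fun_def)
  have "\<bar>a * b\<bar> \<le> a\<^sup>2 + b\<^sup>2" for a b :: real
  proof -
    have "2 * (\<bar>a\<bar> * \<bar>b\<bar>) \<le> a\<^sup>2 + b\<^sup>2"
      using sum_squares_bound[of "\<bar>a\<bar>" "\<bar>b\<bar>"] by simp
    moreover have "0 \<le> \<bar>a\<bar> * \<bar>b\<bar>" by simp
    ultimately show ?thesis unfolding abs_mult by linarith
  qed
  then show "AE x in M. norm (f x * g x) \<le> norm ((f x)\<^sup>2 + (g x)\<^sup>2)" by simp
qed

lemma L2_fun_add:
  assumes "L2_fun M f" "L2_fun M g"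
  shows "L2_fun M (\<lambda>x. f x + g x)"
proof -
  note [measurable] = L2_funD(1)[OF assms(1)] L2_funD(1)[OF assms(2)]
  have "integrable M (\<lambda>x. (f x)\<^sup>2 + (g x)\<^sup>2 + 2 * (f x * g x))"
    using L2_fun_mult_integrable[OF assms] assms by (auto simp: L2_fun_def)
  then show ?thesis by (simp add: L2_fun_def power2_sum mult.assoc)
qed

lemma L2_fun_cmult: "L2_fun M f \<Longrightarrow> L2_fun M (\<lambda>x. c * f x)" for c :: real
  by (auto simp: L2_fun_def power_mult_distrib)

lemma L2_fun_diff:
  assumes "L2_fun M f" "L2_fun M g"
  shows "L2_fun M (\<lambda>x. f x - g x)"
  using L2_fun_add[OF assms(1) L2_fun_cmult[OF assms(2), of "-1"]] by simp

lemma L2_fun_sum: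
  assumes "\<And>i. i \<in> I \<Longrightarrow> L2_fun M (f i)"
  shows "L2_fun M (\<lambda>x. \<Sum>i\<in>I. f i x)"
  using assms
  by (induction I rule: infinite_finite_induct) (auto intro: L2_fun_add simp: L2_fun_def[of _ "\<lambda>_. 0"])

lemma L2_fun_AE_cong:
  assumes "L2_fun M f" "AE x in M. f x = g x" "g \<in> borel_measurable M"
  shows "L2_fun M g"
proof -
  note [measurable] = L2_funD(1)[OF assms(1)] assms(3)
  have "integrable M (\<lambda>x. (f x)\<^sup>2) \<longleftrightarrow> integrable M (\<lambda>x. (g x)\<^sup>2)"
    by (rule integrable_cong_AE) (use assms(2) in auto)
  then show ?thesis using assms by (auto simp: L2_fun_def)
qed

context prob_space
begin

lemma L2_fun_const: "L2_fun M (\<lambda>_. c)" by (simp add: L2_fun_def)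

lemma L2_fun_integrable: "L2_fun M f \<Longrightarrow> integrable M f"
  by (auto simp: L2_fun_def intro: square_integrable_imp_integrable)

lemma real_cond_exp_L2:
  assumes F: "subalgebra M F" and f: "L2_fun M f"
  shows "L2_fun M (real_cond_exp M F f)"
    and "(\<integral>x. (real_cond_exp M F f x)\<^sup>2 \<partial>M) \<le> (\<integral>x. (f x)\<^sup>2 \<partial>M)"
proof -
  interpret finite_measure_subalgebra M F by standard (rule F)
  have i: "integrable M f" "integrable M (\<lambda>x. (f x)\<^sup>2)"
    by (rule L2_fun_integrable[OF f], rule L2_funD(2)[OF f])
  have i2: "integrable M (\<lambda>x. (real_cond_exp M F f x)\<^sup>2)"
    by (rule integrable_convex_cond_exp[where I = UNIV]) (auto intro: i convex_power2)
  then show "L2_fun M (real_cond_exp M F f)" by (simp add: L2_fun_def)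
  have "AE x in M. (real_cond_exp M F f x)\<^sup>2 \<le> real_cond_exp M F (\<lambda>x. (f x)\<^sup>2) x"
    by (rule real_cond_exp_jensens_inequality[where I = UNIV]) (auto intro: i convex_power2)
  then have "(\<integral>x. (real_cond_exp M F f x)\<^sup>2 \<partial>M) \<le> (\<integral>x. real_cond_exp M F (\<lambda>x. (f x)\<^sup>2) x \<partial>M)"
    by (intro integral_mono_AE i2 real_cond_exp_int i)
  then show "(\<integral>x. (real_cond_exp M F f x)\<^sup>2 \<partial>M) \<le> (\<integral>x. (f x)\<^sup>2 \<partial>M)"
    using real_cond_exp_int(2)[OF i(2)] by simp
qed

lemma real_cond_exp_self_adjoint:
  assumes F: "subalgebra M F" and f: "L2_fun M f" and g: "L2_fun M g"
  shows "(\<integral>x. g x * real_cond_exp M F f x \<partial>M) = (\<integral>x. real_cond_exp M F g x * real_cond_exp M F f x \<partial>M)"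
proof -
  interpret finite_measure_subalgebra M F by standard (rule F)
  have "(\<integral>x. real_cond_exp M F f x * real_cond_exp M F g x \<partial>M) = (\<integral>x. real_cond_exp M F f x * g x \<partial>M)"
  proof (rule real_cond_exp_intg(2))
    show "integrable M (\<lambda>x. real_cond_exp M F f x * g x)"
      by (rule L2_fun_mult_integrable[OF real_cond_exp_L2(1)[OF F f] g])
    show "g \<in> borel_measurable M" by (rule L2_funD(1)[OF g])
  qed simp
  then show ?thesis by (simp add: mult.commute)
qed

end

locale cond_exp_mixture = prob_space +
  fixes F :: "'i \<Rightarrow> 'a measure" and I :: "'i set" and p :: "'i \<Rightarrow> real"
  assumes p_nonneg: "\<And>i. i \<in> I \<Longrightarrow> 0 \<le> p i"
    and p_sum: "(\<Sum>i\<in>I. p i) = 1"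
    and F_sub: "\<And>i. i \<in> I \<Longrightarrow> subalgebra M (F i)"
begin

abbreviation E :: "'i \<Rightarrow> ('a \<Rightarrow> real) \<Rightarrow> 'a \<Rightarrow> real" where
  "E i f \<equiv> real_cond_exp M (F i) f"

text \<open>The quadratic form <f, \<open>mixture\<close> f>: each conditional expectation is
  self-adjoint and idempotent, so <f, E_i f> is the squared norm of E_i f.\<close>

abbreviation energy :: "('a \<Rightarrow> real) \<Rightarrow> real" where
  "energy f \<equiv> (\<Sum>i\<in>I. p i * (\<integral>x. (E i f x)\<^sup>2 \<partial>M))"

definition mixture :: "('a \<Rightarrow> real) \<Rightarrow> 'a \<Rightarrow> real" where
  "mixture f x = (\<Sum>i\<in>I. p i * E i f x)"

lemma L2_fun_mixture: "L2_fun M f \<Longrightarrow> L2_fun M (mixture f)"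
  unfolding mixture_def by (intro L2_fun_sum L2_fun_cmult real_cond_exp_L2 F_sub)

lemma integral_mixture:
  assumes f: "L2_fun M f"
  shows "(\<integral>x. mixture f x \<partial>M) = (\<integral>x. f x \<partial>M)"
proof -
  have "(\<integral>x. E i f x \<partial>M) = (\<integral>x. f x \<partial>M)" "integrable M (E i f)" if "i \<in> I" for i
  proof -
    interpret finite_measure_subalgebra M "F i" by standard (rule F_sub[OF that])
    show "(\<integral>x. E i f x \<partial>M) = (\<integral>x. f x \<partial>M)" "integrable M (E i f)"
      using real_cond_exp_int[OF L2_fun_integrable[OF f]] by auto
  qed
  then have "(\<integral>x. mixture f x \<partial>M) = (\<Sum>i\<in>I. p i * (\<integral>x. f x \<partial>M))"
    unfolding mixture_def by (subst Bochner_Integration.integral_sum) auto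
  then show ?thesis using p_sum by (simp add: sum_distrib_right[symmetric])
qed

text \<open>The mixture is a positive self-adjoint operator, so a bound of its quadratic form on the
  mean zero functions bounds its norm there.\<close>

lemma mixture_contraction:
  assumes c: "c > 0" and H: "\<And>f. L2_fun M f \<Longrightarrow> (\<integral>x. f x \<partial>M) = 0 \<Longrightarrow> energy f \<le> c * (\<integral>x. (f x)\<^sup>2 \<partial>M)"
    and f: "L2_fun M f" "(\<integral>x. f x \<partial>M) = 0"
  shows "(\<integral>x. (mixture f x)\<^sup>2 \<partial>M) \<le> c\<^sup>2 * (\<integral>x. (f x)\<^sup>2 \<partial>M)"
proof -
  define g where "g = mixture f"
  have g: "L2_fun M g" "(\<integral>x. g x \<partial>M) = 0"
    using f by (auto simp: g_def L2_fun_mixture integral_mixture)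
  have EL: "L2_fun M (E i h)" if "i \<in> I" "L2_fun M h" for i h
    using that by (intro real_cond_exp_L2 F_sub)
  \<comment> \<open>The weight c balances the two terms: the energy of f is at most c |f|^2, so c
    times it gives c^2 |f|^2, while the energy of g divided by c gives |g|^2.\<close>
  have half: "a * b \<le> (c * a\<^sup>2 + b\<^sup>2 / c) / 2" for a b :: real
  proof -
    have "0 \<le> (c * a - b)\<^sup>2 / c" using c by simp
    also have "\<dots> = c * a\<^sup>2 + b\<^sup>2 / c - 2 * (a * b)" using c by (simp add: power2_eq_square field_simps)
    finally show ?thesis by simp
  qed
  have "(\<integral>x. (g x)\<^sup>2 \<partial>M) = (\<integral>x. (\<Sum>i\<in>I. p i * (g x * E i f x)) \<partial>M)"
    by (simp add: power2_eq_square g_def mixture_def sum_distrib_left mult_ac)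
  also have "\<dots> = (\<Sum>i\<in>I. p i * (\<integral>x. g x * E i f x \<partial>M))"
    by (subst Bochner_Integration.integral_sum) (auto intro!: L2_fun_mult_integrable EL f g)
  also have "\<dots> \<le> (\<Sum>i\<in>I. p i * ((c * (\<integral>x. (E i f x)\<^sup>2 \<partial>M) + (\<integral>x. (E i g x)\<^sup>2 \<partial>M) / c) / 2))"
  proof (intro sum_mono mult_left_mono p_nonneg)
    fix i assume i: "i \<in> I"
    have int: "integrable M (\<lambda>x. (E i f x)\<^sup>2)" "integrable M (\<lambda>x. (E i g x)\<^sup>2)"
      using EL[OF i f(1)] EL[OF i g(1)] by (auto simp: L2_fun_def)
    have "(\<integral>x. g x * E i f x \<partial>M) = (\<integral>x. E i f x * E i g x \<partial>M)"
      using real_cond_exp_self_adjoint[OF F_sub[OF i] f(1) g(1)] by (simp add: mult.commute)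
    also have "\<dots> \<le> (\<integral>x. (c * (E i f x)\<^sup>2 + (E i g x)\<^sup>2 / c) / 2 \<partial>M)"
      by (intro integral_mono L2_fun_mult_integrable EL i f g half) (use int in auto)
    also have "\<dots> = (c * (\<integral>x. (E i f x)\<^sup>2 \<partial>M) + (\<integral>x. (E i g x)\<^sup>2 \<partial>M) / c) / 2"
      using int by simp
    finally show "(\<integral>x. g x * E i f x \<partial>M) \<le> (c * (\<integral>x. (E i f x)\<^sup>2 \<partial>M) + (\<integral>x. (E i g x)\<^sup>2 \<partial>M) / c) / 2" .
  qed
  also have "\<dots> = (c * energy f + energy g / c) / 2"
    by (simp add: sum_distrib_left sum_divide_distrib sum.distrib[symmetric] add_divide_distrib distrib_left mult_ac)
  also have "\<dots> \<le> (c * (c * (\<integral>x. (f x)\<^sup>2 \<partial>M)) + (c * (\<integral>x. (g x)\<^sup>2 \<partial>M)) / c) / 2"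
    using H[OF f] H[OF g] c by (intro divide_right_mono add_mono mult_left_mono) auto
  also have "\<dots> = (c\<^sup>2 * (\<integral>x. (f x)\<^sup>2 \<partial>M) + (\<integral>x. (g x)\<^sup>2 \<partial>M)) / 2"
    using c by (simp add: power2_eq_square)
  \<comment> \<open>The chain ends in |g|^2 <= (c^2 |f|^2 + |g|^2)/2, and half of |g|^2 is absorbed
    on the left.\<close>
  finally show ?thesis by (simp add: g_def)
qed

text \<open>Used twice, to pass from trigonometric polynomials to bounded functions with a constant
  majorant, and from these to L2 with majorant |f|. The term with the squared mean spares centering
  the approximants.\<close>

lemma energy_limit:
  assumes L2: "\<And>n. L2_fun M (t n)" and w: "L2_fun M w" and bd: "\<And>n x. \<bar>t n x\<bar> \<le> w x"
    and lim: "AE x in M. (\<lambda>n. t n x) \<longlonglongrightarrow> f x" and f[measurable]: "f \<in> borel_measurable M"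
    and G: "\<And>n. energy (t n) \<le> c * (\<integral>x. (t n x)\<^sup>2 \<partial>M) + d * (\<integral>x. t n x \<partial>M)\<^sup>2"
  shows "energy f \<le> c * (\<integral>x. (f x)\<^sup>2 \<partial>M) + d * (\<integral>x. f x \<partial>M)\<^sup>2"
proof -
  note [measurable] = L2_funD(1)[OF L2] L2_funD(1)[OF w]
  have iw: "integrable M w" "integrable M (\<lambda>x. (w x)\<^sup>2)" 
    by (rule L2_fun_integrable[OF w], rule L2_funD(2)[OF w])
  have sq: "\<bar>a\<bar> \<le> b \<Longrightarrow> a\<^sup>2 \<le> b\<^sup>2" for a b :: real by (metis abs_ge_zero power2_abs power_mono)
  have fb: "AE x in M. \<bar>f x\<bar> \<le> w x"
    using lim
  proof eventually_elim
    case (elim x)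
    then have "(\<lambda>n. \<bar>t n x\<bar>) \<longlonglongrightarrow> \<bar>f x\<bar>" by (rule tendsto_rabs)
    then show ?case by (rule LIMSEQ_le_const2) (use bd in auto)
  qed
  have i1: "(\<lambda>n. \<integral>x. t n x \<partial>M) \<longlonglongrightarrow> (\<integral>x. f x \<partial>M)"
    by (rule integral_dominated_convergence[where w = w]) (use iw lim bd in auto)
  have i2: "(\<lambda>n. \<integral>x. (t n x)\<^sup>2 \<partial>M) \<longlonglongrightarrow> (\<integral>x. (f x)\<^sup>2 \<partial>M)"
  proof (rule integral_dominated_convergence[where w = "\<lambda>x. (w x)\<^sup>2"])
    show "AE x in M. (\<lambda>n. (t n x)\<^sup>2) \<longlonglongrightarrow> (f x)\<^sup>2" using lim by eventually_elim (rule tendsto_power)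
  qed (use iw sq[OF bd] in auto)
  have if2: "integrable M (\<lambda>x. (f x)\<^sup>2)"
    by (rule Bochner_Integration.integrable_bound[OF iw(2)]) (use fb in \<open>auto dest: sq\<close>)
  then have fL2: "L2_fun M f" by (simp add: L2_fun_def)
  have i3: "(\<lambda>n. \<integral>x. (f x - t n x)\<^sup>2 \<partial>M) \<longlonglongrightarrow> (\<integral>x. 0 \<partial>M)"
  proof (rule integral_dominated_convergence[where w = "\<lambda>x. 4 * (w x)\<^sup>2"])
    show "AE x in M. (\<lambda>n. (f x - t n x)\<^sup>2) \<longlonglongrightarrow> 0"
      using lim
    proof eventually_elim
      case (elim x)
      have "(\<lambda>n. (f x - t n x)\<^sup>2) \<longlonglongrightarrow> (f x - f x)\<^sup>2" by (intro tendsto_power tendsto_diff tendsto_const elim)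
      then show ?case by simp
    qed
    show "AE x in M. norm ((f x - t n x)\<^sup>2) \<le> 4 * (w x)\<^sup>2" for n
      using fb
    proof eventually_elim
      case (elim x)
      have "\<bar>f x - t n x\<bar> \<le> 2 * w x" using elim bd[of n x] by linarith
      from sq[OF this] show ?case by (simp add: power_mult_distrib)
    qed
  qed (use iw in auto)
  \<comment> \<open>Perturbation by Young's inequality together with the L2 contractivity of E_i.
    First n tends to infinity for fixed \<open>\<eta>\<close>, which removes the last term; then
    \<open>\<eta>\<close> tends to 0.\<close>
  have step: "energy f \<le> (1 + \<eta>) * energy (t n) + (1 + 1 / \<eta>) * (\<integral>x. (f x - t n x)\<^sup>2 \<partial>M)"
    if \<eta>: "\<eta> > 0" for \<eta> n
  proof -
    have sp: "a\<^sup>2 \<le> (1 + \<eta>) * b\<^sup>2 + (1 + 1 / \<eta>) * (a - b)\<^sup>2" for a b :: real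
    proof -
      have "0 \<le> (\<eta> * b - (a - b))\<^sup>2 / \<eta>" using \<eta> by simp
      also have "\<dots> = (1 + \<eta>) * b\<^sup>2 + (1 + 1 / \<eta>) * (a - b)\<^sup>2 - a\<^sup>2"
        using \<eta> by (simp add: power2_eq_square field_simps)
      finally show ?thesis by simp
    qed
    have one: "(\<integral>x. (E i f x)\<^sup>2 \<partial>M) \<le> (1 + \<eta>) * (\<integral>x. (E i (t n) x)\<^sup>2 \<partial>M) + (1 + 1 / \<eta>) * (\<integral>x. (f x - t n x)\<^sup>2 \<partial>M)"
      if i: "i \<in> I" for i
    proof -
      interpret finite_measure_subalgebra M "F i" by standard (rule F_sub[OF i])
      note L = real_cond_exp_L2(1)[OF F_sub[OF i]]
      have d: "L2_fun M (\<lambda>x. f x - t n x)" by (intro L2_fun_diff fL2 L2)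
      have int: "integrable M (\<lambda>x. (E i f x)\<^sup>2)" "integrable M (\<lambda>x. (E i (t n) x)\<^sup>2)"
        "integrable M (\<lambda>x. (E i f x - E i (t n) x)\<^sup>2)"
        using L[OF fL2] L[OF L2] L2_fun_diff[OF L[OF fL2] L[OF L2]] by (auto simp: L2_fun_def)
      have "(\<integral>x. (E i f x)\<^sup>2 \<partial>M) \<le> (\<integral>x. (1 + \<eta>) * (E i (t n) x)\<^sup>2 + (1 + 1 / \<eta>) * (E i f x - E i (t n) x)\<^sup>2 \<partial>M)"
        by (intro integral_mono sp) (use int in auto)
      also have "\<dots> = (1 + \<eta>) * (\<integral>x. (E i (t n) x)\<^sup>2 \<partial>M) + (1 + 1 / \<eta>) * (\<integral>x. (E i f x - E i (t n) x)\<^sup>2 \<partial>M)"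
        using int by simp
      also have "(\<integral>x. (E i f x - E i (t n) x)\<^sup>2 \<partial>M) = (\<integral>x. (E i (\<lambda>x. f x - t n x) x)\<^sup>2 \<partial>M)"
      proof (rule integral_cong_AE)
        show "AE x in M. (E i f x - E i (t n) x)\<^sup>2 = (E i (\<lambda>x. f x - t n x) x)\<^sup>2"
          using real_cond_exp_diff[OF L2_fun_integrable[OF fL2] L2_fun_integrable[OF L2[of n]]]
          by eventually_elim simp
      qed auto
      finally have le: "(\<integral>x. (E i f x)\<^sup>2 \<partial>M) \<le> (1 + \<eta>) * (\<integral>x. (E i (t n) x)\<^sup>2 \<partial>M) +
          (1 + 1 / \<eta>) * (\<integral>x. (E i (\<lambda>x. f x - t n x) x)\<^sup>2 \<partial>M)" .
      have "(1 + 1 / \<eta>) * (\<integral>x. (E i (\<lambda>x. f x - t n x) x)\<^sup>2 \<partial>M) \<le> (1 + 1 / \<eta>) * (\<integral>x. (f x - t n x)\<^sup>2 \<partial>M)"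
        using \<eta> by (intro mult_left_mono real_cond_exp_L2(2)[OF F_sub[OF i] d]) auto
      with le show ?thesis by linarith
    qed
    have "energy f \<le> (\<Sum>i\<in>I. p i * ((1 + \<eta>) * (\<integral>x. (E i (t n) x)\<^sup>2 \<partial>M) + (1 + 1 / \<eta>) * (\<integral>x. (f x - t n x)\<^sup>2 \<partial>M)))"
      by (intro sum_mono mult_left_mono one p_nonneg)
    also have "\<dots> = (1 + \<eta>) * energy (t n) + (\<Sum>i\<in>I. p i) * ((1 + 1 / \<eta>) * (\<integral>x. (f x - t n x)\<^sup>2 \<partial>M))"
      unfolding sum_distrib_left sum_distrib_right sum.distrib[symmetric]
      by (intro sum.cong) (simp_all add: algebra_simps)
    finally show ?thesis by (simp add: p_sum)
  qed
  define y where "y = c * (\<integral>x. (f x)\<^sup>2 \<partial>M) + d * (\<integral>x. f x \<partial>M)\<^sup>2"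
  have "energy f \<le> (1 + \<eta>) * y" if \<eta>: "\<eta> > 0" for \<eta>
  proof -
    have "(\<lambda>n. (1 + \<eta>) * (c * (\<integral>x. (t n x)\<^sup>2 \<partial>M) + d * (\<integral>x. t n x \<partial>M)\<^sup>2) + (1 + 1 / \<eta>) * (\<integral>x. (f x - t n x)\<^sup>2 \<partial>M))
        \<longlonglongrightarrow> (1 + \<eta>) * y + (1 + 1 / \<eta>) * (\<integral>x. 0 \<partial>M)"
      unfolding y_def by (intro tendsto_intros i1 i2 i3)
    moreover have "energy f \<le> (1 + \<eta>) * (c * (\<integral>x. (t n x)\<^sup>2 \<partial>M) + d * (\<integral>x. t n x \<partial>M)\<^sup>2) + (1 + 1 / \<eta>) * (\<integral>x. (f x - t n x)\<^sup>2 \<partial>M)" for n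
    proof -
      have "(1 + \<eta>) * energy (t n) \<le> (1 + \<eta>) * (c * (\<integral>x. (t n x)\<^sup>2 \<partial>M) + d * (\<integral>x. t n x \<partial>M)\<^sup>2)"
        using G[of n] \<eta> by (intro mult_left_mono) auto
      then show ?thesis using step[OF \<eta>, of n] by linarith
    qed
    ultimately have "energy f \<le> (1 + \<eta>) * y + (1 + 1 / \<eta>) * (\<integral>x. 0 \<partial>M)"
      by (intro LIMSEQ_le_const) auto
    then show ?thesis by simp
  qed
  then have "\<exists>N. \<forall>n\<ge>N. energy f \<le> (1 + 1 / real (Suc n)) * y" by (intro exI[of _ 0]) simp
  moreover have "(\<lambda>n. (1 + 1 / real (Suc n)) * y) \<longlonglongrightarrow> (1 + 0) * y"
    using LIMSEQ_inverse_real_of_nat by (intro tendsto_intros) (simp add: inverse_eq_divide)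
  ultimately show ?thesis using LIMSEQ_le_const unfolding y_def by fastforce
qed

end

section \<open>Block conditionals as conditional expectations\<close>

text \<open>These are the sets of the sigma-algebra generated by x_{-i}: Borel sets that are unions
  of fibres of x -> x_{-i}. The form matches the test sets in
  \<open>is_block_conditional\<close>.\<close>

definition saturated :: "('n \<Rightarrow> 'b) \<Rightarrow> 'b \<Rightarrow> (real^'n) set set" where
  "saturated blk i = {B \<in> sets borel. \<forall>x x'. same_off blk i x x' \<longrightarrow> (x \<in> B \<longleftrightarrow> x' \<in> B)}"

definition off_algebra :: "('n \<Rightarrow> 'b) \<Rightarrow> 'b \<Rightarrow> (real^'n) measure" where
  "off_algebra blk i = sigma UNIV (saturated blk i)"

lemma sigma_algebra_saturated:
  fixes blk :: "'n::finite \<Rightarrow> 'b"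
  shows "sigma_algebra UNIV (saturated blk i)"
  unfolding sigma_algebra_iff2
proof (intro conjI ballI allI impI)
  show "saturated blk i \<subseteq> Pow UNIV" by simp
  show "{} \<in> saturated blk i" by (simp add: saturated_def)
  fix A assume "A \<in> saturated blk i"
  then show "UNIV - A \<in> saturated blk i" by (auto simp: saturated_def)
next
  fix A :: "nat \<Rightarrow> (real^'n) set" assume A: "range A \<subseteq> saturated blk i"
  then have "(\<Union>n. A n) \<in> sets borel" by (auto simp: saturated_def)
  moreover have "x \<in> (\<Union>n. A n) \<longleftrightarrow> x' \<in> (\<Union>n. A n)" if "same_off blk i x x'" for x x'
    using A that unfolding saturated_def by blast
  ultimately show "(\<Union>n. A n) \<in> saturated blk i" by (simp add: saturated_def)
qed

lemma sets_off_algebra[simp]: "sets (off_algebra blk i) = saturated blk i"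
  unfolding off_algebra_def by (rule sigma_algebra.sets_measure_of_eq[OF sigma_algebra_saturated])

lemma space_off_algebra[simp]: "space (off_algebra blk i) = UNIV"
  by (simp add: off_algebra_def)

lemma subalgebra_off_algebra:
  "sets M = sets borel \<Longrightarrow> subalgebra M (off_algebra blk i)"
  unfolding subalgebra_def by (auto simp: saturated_def dest: sets_eq_imp_space_eq)

lemma borel_measurable_off_algebra:
  fixes g :: "real^'n \<Rightarrow> real"
  assumes g: "g \<in> borel_measurable borel" and inv: "\<And>x x'. same_off blk i x x' \<Longrightarrow> g x = g x'"
  shows "g \<in> borel_measurable (off_algebra blk i)"
proof (rule measurableI)
  fix A :: "real set" assume "A \<in> sets borel"
  then have "g -` A \<in> sets borel" using measurable_sets[OF g] by simp
  then show "g -` A \<inter> space (off_algebra blk i) \<in> sets (off_algebra blk i)"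
    using inv by (auto simp: saturated_def)
qed simp

locale block_kernel = prob_space M for M :: "(real^'n) measure" +
  fixes blk :: "'n \<Rightarrow> 'b" and i :: 'b and k :: "real^'n \<Rightarrow> (real^'n) measure"
  assumes sets_M[simp, measurable_cong]: "sets M = sets borel" and k: "is_block_conditional M blk i k"
begin

lemma space_M[simp]: "space M = UNIV" using sets_eq_imp_space_eq[OF sets_M] by simp

lemma k_measurable[measurable]: "k \<in> borel \<rightarrow>\<^sub>M subprob_algebra borel"
  by (rule measurable_prob_algebraD) (rule k[unfolded is_block_conditional_def, THEN conjunct1])

lemma sets_k[simp, measurable_cong]: "sets (k x) = sets borel"
  using sets_kernel[OF k_measurable, of x] by simp

lemma k_cong: "same_off blk i x x' \<Longrightarrow> k x = k x'"
  using k unfolding is_block_conditional_def by blast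

lemma k_integral:
  assumes A: "A \<in> sets borel" and B: "B \<in> saturated blk i"
  shows "(\<integral>\<^sup>+ x. indicator B x * emeasure (k x) A \<partial>M) = emeasure M (A \<inter> B)"
  using k A B unfolding is_block_conditional_def saturated_def by blast

text \<open>The defining property says that the restriction of \<open>M\<close> to a saturated set
  \<open>B\<close> is stationary for \<open>k\<close>. Stated as \<open>N \<bind> k = N\<close>, it
  extends from sets to functions at once.\<close>

lemma nn_integral_k:
  assumes B: "B \<in> saturated blk i" and g[measurable]: "g \<in> borel_measurable borel"
  shows "(\<integral>\<^sup>+ x. indicator B x * (\<integral>\<^sup>+ y. g y \<partial>k x) \<partial>M) = (\<integral>\<^sup>+ x. indicator B x * g x \<partial>M)"
proof -
  have Bm[measurable]: "B \<in> sets borel" using B by (simp add: saturated_def)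
  define N where "N = density M (indicator B)"
  have N: "sets N = sets borel" "space N = UNIV" by (simp_all add: N_def)
  note [measurable_cong] = N(1)
  have kN: "k \<in> N \<rightarrow>\<^sub>M subprob_algebra borel" using k_measurable by measurable
  have "N \<bind> k = N"
  proof (rule measure_eqI)
    show "sets (N \<bind> k) = sets N" using sets_bind[OF sets_kernel[OF kN], of N] by (simp add: N)
    fix A assume "A \<in> sets (N \<bind> k)"
    then have A[measurable]: "A \<in> sets borel" using sets_bind[OF sets_kernel[OF kN], of N] by (simp add: N)
    have "emeasure (N \<bind> k) A = (\<integral>\<^sup>+x. emeasure (k x) A \<partial>N)"
      by (rule emeasure_bind[OF _ kN]) (simp_all add: N)
    also have "\<dots> = (\<integral>\<^sup>+x. indicator B x * emeasure (k x) A \<partial>M)"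
      unfolding N_def by (rule nn_integral_density) measurable
    also have "\<dots> = emeasure M (A \<inter> B)" by (rule k_integral[OF A B])
    also have "\<dots> = emeasure N A"
      unfolding N_def by (subst emeasure_density) (auto simp: indicator_inter_arith[symmetric] Int_commute)
    finally show "emeasure (N \<bind> k) A = emeasure N A" .
  qed
  then have "(\<integral>\<^sup>+x. g x \<partial>N) = (\<integral>\<^sup>+x. \<integral>\<^sup>+y. g y \<partial>k x \<partial>N)"
    using nn_integral_bind[OF g kN] by simp
  moreover have "(\<integral>\<^sup>+x. g x \<partial>N) = (\<integral>\<^sup>+ x. indicator B x * g x \<partial>M)"
    unfolding N_def by (rule nn_integral_density) measurable
  moreover have "(\<integral>\<^sup>+x. \<integral>\<^sup>+y. g y \<partial>k x \<partial>N) = (\<integral>\<^sup>+ x. indicator B x * (\<integral>\<^sup>+ y. g y \<partial>k x) \<partial>M)"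
    unfolding N_def by (rule nn_integral_density) measurable
  ultimately show ?thesis by simp
qed

lemma UNIV_saturated: "UNIV \<in> saturated blk i" by (simp add: saturated_def)

text \<open>Where \<open>f\<close> is not integrable under \<open>k x\<close>, the Bochner integral
  in \<open>rsgs_op\<close> takes its default value 0; this confines such points to a null
  set.\<close>

lemma AE_integrable_k:
  fixes f :: "real^'n \<Rightarrow> real"
  assumes f: "integrable M f"
  shows "AE x in M. integrable (k x) f"
proof -
  have [measurable]: "f \<in> borel_measurable borel"
    using borel_measurable_integrable[OF f] by (simp only: measurable_cong_sets[OF sets_M refl])
  have "(\<integral>\<^sup>+x. \<integral>\<^sup>+y. ennreal (norm (f y)) \<partial>k x \<partial>M) = (\<integral>\<^sup>+x. ennreal (norm (f x)) \<partial>M)"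
    using nn_integral_k[OF UNIV_saturated, of "\<lambda>y. ennreal (norm (f y))"] by simp
  also have "\<dots> < \<infinity>" using f by (simp add: integrable_iff_bounded)
  finally have "AE x in M. (\<integral>\<^sup>+y. ennreal (norm (f y)) \<partial>k x) \<noteq> \<infinity>"
    by (intro nn_integral_PInf_AE) auto
  then show ?thesis
    by eventually_elim (auto simp: integrable_iff_bounded less_top)
qed

lemma k_integral_measurable[measurable]:
  fixes f :: "real^'n \<Rightarrow> real"
  assumes [measurable]: "f \<in> borel_measurable borel"
  shows "(\<lambda>x. \<integral>y. f y \<partial>k x) \<in> borel_measurable borel"
  by (rule measurable_compose[OF k_measurable integral_measurable_subprob_algebra]) simp

lemma k_integral_nonneg_eq:
  fixes f :: "real^'n \<Rightarrow> real"
  assumes f: "integrable M f" and nn: "\<And>x. 0 \<le> f x" and B: "B \<in> saturated blk i"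
  shows "integrable M (\<lambda>x. \<integral>y. f y \<partial>k x)"
    and "(\<integral>x. indicator B x * (\<integral>y. f y \<partial>k x) \<partial>M) = (\<integral>x. indicator B x * f x \<partial>M)"
proof -
  have fm[measurable]: "f \<in> borel_measurable borel"
    using borel_measurable_integrable[OF f] by (simp only: measurable_cong_sets[OF sets_M refl])
  have [measurable]: "B \<in> sets borel" using B by (simp add: saturated_def)
  have int: "(\<integral>\<^sup>+ x. indicator C x * ennreal (\<integral>y. f y \<partial>k x) \<partial>M) = (\<integral>\<^sup>+ x. indicator C x * ennreal (f x) \<partial>M)"
    if C: "C \<in> saturated blk i" for C
  proof -
    have "AE x in M. ennreal (\<integral>y. f y \<partial>k x) = (\<integral>\<^sup>+y. ennreal (f y) \<partial>k x)"
      using AE_integrable_k[OF f] by eventually_elim (simp add: nn_integral_eq_integral nn)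
    then have "(\<integral>\<^sup>+ x. indicator C x * ennreal (\<integral>y. f y \<partial>k x) \<partial>M) = (\<integral>\<^sup>+ x. indicator C x * (\<integral>\<^sup>+y. ennreal (f y) \<partial>k x) \<partial>M)"
      by (intro nn_integral_cong_AE) auto
    then show ?thesis using nn_integral_k[OF C, of "\<lambda>y. ennreal (f y)"] by simp
  qed
  have nnk: "0 \<le> (\<integral>y. f y \<partial>k x)" for x using nn by simp
  show "integrable M (\<lambda>x. \<integral>y. f y \<partial>k x)"
  proof (rule integrableI_nonneg)
    have "(\<integral>\<^sup>+ x. ennreal (\<integral>y. f y \<partial>k x) \<partial>M) = (\<integral>\<^sup>+ x. ennreal (f x) \<partial>M)"
      using int[OF UNIV_saturated] by simp
    also have "\<dots> < \<infinity>" using f nn by (simp add: nn_integral_eq_integral)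
    finally show "(\<integral>\<^sup>+ x. ennreal (\<integral>y. f y \<partial>k x) \<partial>M) < \<infinity>" .
  qed (use nnk in auto)
  have ind: "ennreal (indicator B x * r) = indicator B x * ennreal r" for x and r :: real
    by (auto simp: indicator_def)
  have "(\<integral>x. indicator B x * (\<integral>y. f y \<partial>k x) \<partial>M) = enn2real (\<integral>\<^sup>+x. ennreal (indicator B x * (\<integral>y. f y \<partial>k x)) \<partial>M)"
    by (rule integral_eq_nn_integral) (auto simp: nnk)
  also have "\<dots> = enn2real (\<integral>\<^sup>+x. ennreal (indicator B x * f x) \<partial>M)"
    unfolding ind int[OF B] ..
  also have "\<dots> = (\<integral>x. indicator B x * f x \<partial>M)"
    by (rule integral_eq_nn_integral[symmetric]) (auto simp: nn)
  finally show "(\<integral>x. indicator B x * (\<integral>y. f y \<partial>k x) \<partial>M) = (\<integral>x. indicator B x * f x \<partial>M)" .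
qed

text \<open>Links the given kernel, whatever version of the conditional law it is, to the
  conditional expectation. Positive and negative parts are treated separately because
  \<open>nn_integral_k\<close> concerns nonnegative functions.\<close>

lemma real_cond_exp_block_kernel:
  fixes f :: "real^'n \<Rightarrow> real"
  assumes f: "integrable M f"
  shows "AE x in M. real_cond_exp M (off_algebra blk i) f x = (\<integral>y. f y \<partial>k x)"
proof -
  interpret finite_measure_subalgebra M "off_algebra blk i"
    by standard (rule subalgebra_off_algebra[OF sets_M])
  have [measurable]: "f \<in> borel_measurable borel"
    using borel_measurable_integrable[OF f] by (simp only: measurable_cong_sets[OF sets_M refl])
  define fp where "fp x = max 0 (f x)" for x
  define fm where "fm x = max 0 (- f x)" for x
  have pm: "integrable M fp" "integrable M fm" "\<And>x. 0 \<le> fp x" "\<And>x. 0 \<le> fm x"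
    using f by (auto simp: fp_def[abs_def] fm_def[abs_def])
  have fpm: "f x = fp x - fm x" for x by (simp add: fp_def fm_def)
  have [measurable]: "fp \<in> borel_measurable borel" "fm \<in> borel_measurable borel"
    unfolding fp_def[abs_def] fm_def[abs_def] by measurable
  have kf: "AE x in M. (\<integral>y. f y \<partial>k x) = (\<integral>y. fp y \<partial>k x) - (\<integral>y. fm y \<partial>k x)"
    using AE_integrable_k[OF pm(1)] AE_integrable_k[OF pm(2)]
  proof eventually_elim
    case (elim x)
    then show ?case unfolding fpm by (rule Bochner_Integration.integral_diff)
  qed
  note ip = k_integral_nonneg_eq[OF pm(1,3)] and im = k_integral_nonneg_eq[OF pm(2,4)]
  show ?thesis
  proof (rule real_cond_exp_charact)
    have "integrable M (\<lambda>x. (\<integral>y. fp y \<partial>k x) - (\<integral>y. fm y \<partial>k x))"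
      by (intro Bochner_Integration.integrable_diff ip(1)[OF UNIV_saturated] im(1)[OF UNIV_saturated])
    then show "integrable M (\<lambda>x. \<integral>y. f y \<partial>k x)"
      by (subst integrable_cong_AE[OF _ _ kf]) auto
    show "(\<lambda>x. \<integral>y. f y \<partial>k x) \<in> borel_measurable (off_algebra blk i)"
      by (rule borel_measurable_off_algebra) (auto simp: k_cong)
    fix A assume "A \<in> sets (off_algebra blk i)"
    then have A: "A \<in> saturated blk i" by simp
    then have [measurable]: "A \<in> sets borel" by (simp add: saturated_def)
    have ii: "integrable M (\<lambda>x. indicator A x * g x)" if "integrable M g" for g :: "real^'n \<Rightarrow> real"
      using integrable_mult_indicator[of A M g] that by simp
    have "(\<integral>x. indicator A x * (\<integral>y. f y \<partial>k x) \<partial>M) =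
        (\<integral>x. indicator A x * (\<integral>y. fp y \<partial>k x) - indicator A x * (\<integral>y. fm y \<partial>k x) \<partial>M)"
      by (rule integral_cong_AE) (use kf in \<open>auto simp: right_diff_distrib\<close>)
    also have "\<dots> = (\<integral>x. indicator A x * fp x \<partial>M) - (\<integral>x. indicator A x * fm x \<partial>M)"
      using ip[OF A] im[OF A] by (simp add: ii)
    also have "\<dots> = (\<integral>x. indicator A x * f x \<partial>M)"
      unfolding fpm right_diff_distrib using pm by (simp add: ii)
    finally show "(\<integral>x\<in>A. f x \<partial>M) = (\<integral>x\<in>A. (\<integral>y. f y \<partial>k x) \<partial>M)"
      unfolding set_lebesgue_integral_def by simp
  qed (rule f)
qed

end

section \<open>The spectral gap\<close>

locale gibbs = gaussian_sqrt \<Sigma> K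
  for \<Sigma> K :: "real^'n^'n" +
  fixes blk :: "'n \<Rightarrow> 'b::finite" and p :: "'b \<Rightarrow> real" and k :: "'b \<Rightarrow> real^'n \<Rightarrow> (real^'n) measure"
  assumes p_pos: "\<And>i. p i > 0" and p_one: "(\<Sum>i\<in>UNIV. p i) = 1"
    and block_k: "\<And>i. is_block_conditional (gaussian \<Sigma>) blk i (k i)"
begin

abbreviation "\<pi> \<equiv> gaussian \<Sigma>"
abbreviation "Q \<equiv> matrix_inv \<Sigma>"
abbreviation "D i \<equiv> block_inv blk Q i"

text \<open>In the coordinates u = K x, the orthogonal projection onto the image under K of the
  vectors supported in block i; \<open>P i\<close> is the complementary projection.\<close>

definition R :: "'b \<Rightarrow> real^'n \<Rightarrow> real^'n" where "R i u = K *v (D i *v (K *v u))"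
definition P :: "'b \<Rightarrow> real^'n \<Rightarrow> real^'n" where "P i u = u - R i u"
definition F1 :: "real^'n^'n" where "F1 = mat 1 - K ** (\<Sum>i\<in>UNIV. p i *\<^sub>R D i) ** K"

abbreviation "rate \<equiv> lambda_max F1"

lemmas pd_Q = pos_def_mat_inv(1)[OF pd]

sublocale cond_exp_mixture \<pi> "off_algebra blk" UNIV p
  by (intro cond_exp_mixture.intro cond_exp_mixture_axioms.intro prob_space_gaussian
        subalgebra_off_algebra sets_gaussian less_imp_le p_pos p_one)

lemma block_kernel: "block_kernel \<pi> blk i (k i)"
  by (intro block_kernel.intro block_kernel_axioms.intro prob_space_gaussian sets_gaussian block_k)

lemma R_symmetric: "x \<bullet> R i y = R i x \<bullet> y"
  unfolding R_def inner_matrix_symmetric[OF K_sym] inner_matrix_symmetric[OF block_inv_transpose[OF pd_Q]] ..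

lemma R_idem: "R i (R i x) = R i x"
proof -
  have "D i *v (K *v (K *v (D i *v y))) = D i *v y" for y
    using block_inv_idem[OF pd_Q, of blk i]
    by (metis K_sq matrix_vector_mul_assoc)
  then show ?thesis by (simp add: R_def)
qed

lemma R_linear: "linear (R i)"
  unfolding R_def by (intro linearI) (simp_all add: matrix_vector_right_distrib matrix_vector_mult_scaleR)

lemma P_linear: "linear (P i)"
  unfolding P_def by (intro linear_compose_sub linear_ident R_linear)

lemma P_symmetric: "x \<bullet> P i y = P i x \<bullet> y"
  by (simp add: P_def inner_diff_left inner_diff_right R_symmetric)

lemma P_idem: "P i (P i x) = P i x"
  by (simp add: P_def linear_diff[OF R_linear] R_idem)

lemma P_proj: "x \<bullet> P i y = P i x \<bullet> P i y"
  by (metis P_symmetric P_idem)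

lemma PR_orth: "P i x \<bullet> R i y = 0"
proof -
  have "P i (R i y) = 0" by (simp add: P_def R_idem)
  then show ?thesis by (metis P_symmetric inner_zero_right)
qed

lemma pythagoras: "P i x \<bullet> P i x + R i x \<bullet> R i x = x \<bullet> x"
proof -
  have "x = P i x + R i x" by (simp add: P_def)
  then have "x \<bullet> x = (P i x + R i x) \<bullet> (P i x + R i x)" by simp
  then show ?thesis by (simp add: inner_add_left inner_add_right PR_orth inner_commute[of "R i x" "P i x"])
qed

lemma F1_mult: "F1 *v x = (\<Sum>i\<in>UNIV. p i *\<^sub>R P i x)"
proof -
  have D: "(\<Sum>i\<in>I. p i *\<^sub>R D i) *v y = (\<Sum>i\<in>I. p i *\<^sub>R (D i *v y))" for I y
    by (induction I rule: infinite_finite_induct)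
       (simp_all add: matrix_vector_mult_add_rdistrib scaleR_matrix_vector_assoc)
  have "F1 *v x = x - K *v ((\<Sum>i\<in>UNIV. p i *\<^sub>R D i) *v (K *v x))"
    by (simp add: F1_def matrix_vector_mult_diff_rdistrib matrix_vector_mul_assoc matrix_mul_assoc)
  also have "\<dots> = x - (\<Sum>i\<in>UNIV. p i *\<^sub>R R i x)"
    by (simp add: D R_def linear_sum[OF matrix_vector_mul_linear] matrix_vector_mult_scaleR)
  also have "\<dots> = (\<Sum>i\<in>UNIV. p i) *\<^sub>R x - (\<Sum>i\<in>UNIV. p i *\<^sub>R R i x)" by (simp add: p_one)
  also have "\<dots> = (\<Sum>i\<in>UNIV. p i *\<^sub>R P i x)"
    unfolding P_def scaleR_diff_right sum_subtractf scaleR_sum_left ..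
  finally show ?thesis .
qed

lemma F1_symmetric: "transpose F1 = F1"
proof -
  have "x v* F1 = F1 *v x" for x
  proof -
    have "(x v* F1) \<bullet> y = (F1 *v x) \<bullet> y" for y
      unfolding dot_lmul_matrix F1_mult by (simp add: inner_sum_left inner_sum_right P_symmetric)
    then show ?thesis by (metis vector_eq_rdot)
  qed
  then show ?thesis by (simp add: matrix_eq)
qed

lemma rate_bound: "(\<Sum>i\<in>UNIV. p i * (x \<bullet> P i x)) \<le> rate * (x \<bullet> x)"
  using lambda_max_symmetric(2)[OF F1_symmetric, of x] by (simp add: F1_mult inner_sum_right)

lemma rate_nonneg: "0 \<le> rate"
proof -
  from lambda_max_symmetric(1)[OF F1_symmetric]
  obtain v where v: "v \<noteq> 0" "F1 *v v = rate *\<^sub>R v" by (elim exE conjE)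
  have "0 \<le> (\<Sum>i\<in>UNIV. p i * (v \<bullet> P i v))"
    by (intro sum_nonneg mult_nonneg_nonneg less_imp_le[OF p_pos]) (subst P_proj, simp)
  then have "0 \<le> rate * (v \<bullet> v)" using rate_bound[of v] by linarith
  moreover have "0 < v \<bullet> v" using v(1) by simp
  ultimately show ?thesis by (metis zero_le_mult_iff not_le)
qed

sublocale PA: projection_average UNIV p P rate
  by (rule projection_average.intro) (rule less_imp_le[OF p_pos] P_linear P_proj rate_bound)+

text \<open>Block i of x - B_i x is the conditional mean - Q_ii^{-1} sum_{j \<noteq> i} Q_ij x_j of
  x_i given x_{-i}, and the other blocks are unchanged. With y an independent copy of x, x - B_i x +
  B_i y is thus an explicit draw from Pr_i started at x.\<close>

definition B :: "'b \<Rightarrow> real^'n^'n" where "B i = D i ** Q"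

lemma K_B: "K *v (B i *v x) = R i (K *v x)"
  by (simp add: B_def R_def K_sq[symmetric] matrix_vector_mul_assoc matrix_mul_assoc)

lemma B_support: "blk j \<noteq> i \<Longrightarrow> (B i *v x) $ j = 0"
  by (simp add: B_def matrix_vector_mul_assoc[symmetric] block_inv_vec_support[OF pd_Q])

lemma K_resample: "K *v (x - B i *v x + B i *v y) = P i (K *v x) + R i (K *v y)"
  by (simp add: P_def matrix_vector_right_distrib matrix_vector_mult_diff_distrib K_B)

lemma same_off_resample: "same_off blk i x (x - B i *v x + B i *v y)"
  by (simp add: same_off_def B_support)

text \<open>The difference of the two points is supported in block i, so K maps it into the range of
  \<open>R i\<close>, which \<open>P i\<close> kills. Functions of P_i K x are therefore measurable
  with respect to x_{-i}.\<close>

lemma P_K_same_off: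
  assumes "same_off blk i x x'"
  shows "P i (K *v x) = P i (K *v x')"
proof -
  have "B i *v (x - x') = x - x'"
    unfolding B_def matrix_vector_mul_assoc[symmetric]
    by (rule block_inv_mult_vec[OF pd_Q]) (use assms in \<open>auto simp: same_off_def\<close>)
  then have "R i (K *v (x - x')) = K *v (x - x')" by (metis K_B)
  then have "P i (K *v (x - x')) = 0" by (simp add: P_def)
  then show ?thesis by (simp add: matrix_vector_mult_diff_distrib linear_diff[OF P_linear])
qed

lemma distr_resample: "distr (\<pi> \<Otimes>\<^sub>M \<pi>) borel (\<lambda>(x, y). x - B i *v x + B i *v y) = \<pi>"
proof (rule distr_gaussian_rotation)
  show "B i ** B i = B i"
    by (simp add: B_def matrix_mul_assoc block_inv_idem[OF pd_Q])
  fix x y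
  define u v where "u = K *v x" and "v = K *v y"
  have 1: "K *v (x - B i *v x + B i *v y) = P i u + R i v" by (simp add: K_resample u_def v_def)
  have 2: "K *v (y - B i *v y - B i *v x) = P i v - R i u"
    by (simp add: P_def matrix_vector_mult_diff_distrib K_B u_def v_def)
  have o: "P i a \<bullet> R i b = 0" "R i b \<bullet> P i a = 0" for a b
    using PR_orth by (simp_all add: inner_commute)
  have "(P i u + R i v) \<bullet> (P i u + R i v) + (P i v - R i u) \<bullet> (P i v - R i u) =
    (P i u \<bullet> P i u + R i u \<bullet> R i u) + (P i v \<bullet> P i v + R i v \<bullet> R i v)"
    by (simp add: inner_add_left inner_add_right inner_diff_left inner_diff_right o)
  then show "(K *v (x - B i *v x + B i *v y)) \<bullet> (K *v (x - B i *v x + B i *v y)) +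
      (K *v (y - B i *v y - B i *v x)) \<bullet> (K *v (y - B i *v y - B i *v x)) =
      (K *v x) \<bullet> (K *v x) + (K *v y) \<bullet> (K *v y)"
    unfolding 1 2 pythagoras unfolding u_def v_def .
qed

text \<open>Resampling keeps the law by \<open>distr_resample\<close> and never leaves a saturated
  set \<open>A\<close>, so the integral of f over A equals that of the average G of f over the
  resampled block.\<close>

lemma E_resample:
  assumes f: "integrable \<pi> f" and G: "G \<in> borel_measurable borel" "integrable \<pi> G"
    and Gf: "\<And>x. (\<integral>y. f (x - B i *v x + B i *v y) \<partial>\<pi>) = G x"
    and G_inv: "\<And>x x'. same_off blk i x x' \<Longrightarrow> G x = G x'"
  shows "AE x in \<pi>. E i f x = G x"
proof -
  interpret finite_measure_subalgebra \<pi> "off_algebra blk i"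
    by standard (rule subalgebra_off_algebra[OF sets_gaussian])
  interpret pair_prob_space \<pi> \<pi> ..
  have [measurable]: "f \<in> borel_measurable borel"
    using borel_measurable_integrable[OF f] by (simp only: measurable_cong_sets[OF sets_gaussian refl])
  let ?T = "\<lambda>(x, y). x - B i *v x + B i *v y"
  have T[measurable]: "?T \<in> \<pi> \<Otimes>\<^sub>M \<pi> \<rightarrow>\<^sub>M borel"
    unfolding split_beta by simp
  show ?thesis
  proof (rule real_cond_exp_charact)
    fix A assume "A \<in> sets (off_algebra blk i)"
    then have A: "A \<in> sets borel" and sat: "\<And>x x'. same_off blk i x x' \<Longrightarrow> x \<in> A \<longleftrightarrow> x' \<in> A"
      by (auto simp: saturated_def)
    note [measurable] = A
    have ind: "indicator A (x - B i *v x + B i *v y) = (indicator A x :: real)" for x y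
      using sat[OF same_off_resample[of i x y]] by (simp add: indicator_def)
    define g where "g x = indicator A x * f x" for x
    have gi: "integrable \<pi> g"
      using integrable_mult_indicator[of A \<pi> f] f by (simp add: g_def[abs_def])
    have gm[measurable]: "g \<in> borel_measurable borel" unfolding g_def[abs_def] by measurable
    have "integrable (distr (\<pi> \<Otimes>\<^sub>M \<pi>) borel ?T) g" unfolding distr_resample by (rule gi)
    then have int: "integrable (\<pi> \<Otimes>\<^sub>M \<pi>) (\<lambda>z. g (?T z))"
      by (subst (asm) integrable_distr_eq) auto
    have "(\<integral>x. g x \<partial>\<pi>) = (\<integral>x. g x \<partial>distr (\<pi> \<Otimes>\<^sub>M \<pi>) borel ?T)" unfolding distr_resample ..
    also have "\<dots> = (\<integral>z. g (?T z) \<partial>(\<pi> \<Otimes>\<^sub>M \<pi>))" by (rule integral_distr) auto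
    also have "\<dots> = (\<integral>x. \<integral>y. g (?T (x, y)) \<partial>\<pi> \<partial>\<pi>)" by (rule integral_fst'[symmetric, OF int])
    also have "\<dots> = (\<integral>x. indicator A x * G x \<partial>\<pi>)"
      by (simp add: g_def ind Gf)
    finally show "(\<integral>x\<in>A. f x \<partial>\<pi>) = (\<integral>x\<in>A. G x \<partial>\<pi>)"
      unfolding set_lebesgue_integral_def by (simp add: g_def)
  next
    show "G \<in> borel_measurable (off_algebra blk i)"
      by (rule borel_measurable_off_algebra[OF G(1) G_inv])
  qed (use f G in auto)
qed

section \<open>The quadratic form inequality, from cosines to all of L2\<close>

lemma integrable_cos: "integrable \<pi> (\<lambda>x. cos (a \<bullet> (C *v x) + \<theta>))" for C :: "real^'n^'n"
  by (rule integrable_const_bound[of _ 1]) auto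

lemma integral_cos_cos:
  "(\<integral>x. cos (a \<bullet> (K *v x) + \<theta>) * cos (b \<bullet> (K *v x) + \<phi>) \<partial>\<pi>) =
     exp (- (a \<bullet> a + b \<bullet> b) / 2) * cos_kernel (a \<bullet> b) \<theta> \<phi>"
proof -
  have "cos (a \<bullet> u + \<theta>) * cos (b \<bullet> u + \<phi>) = (cos ((a - b) \<bullet> u + (\<theta> - \<phi>)) + cos ((a + b) \<bullet> u + (\<theta> + \<phi>))) / 2" for u
  proof -
    have "(a - b) \<bullet> u + (\<theta> - \<phi>) = a \<bullet> u + \<theta> - (b \<bullet> u + \<phi>)"
      "(a + b) \<bullet> u + (\<theta> + \<phi>) = a \<bullet> u + \<theta> + (b \<bullet> u + \<phi>)"
      by (simp_all add: inner_diff_left inner_add_left)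
    then show ?thesis by (simp only: cos_times_cos)
  qed
  then have "(\<integral>x. cos (a \<bullet> (K *v x) + \<theta>) * cos (b \<bullet> (K *v x) + \<phi>) \<partial>\<pi>) =
      (\<integral>x. (cos ((a - b) \<bullet> (K *v x) + (\<theta> - \<phi>)) + cos ((a + b) \<bullet> (K *v x) + (\<theta> + \<phi>))) / 2 \<partial>\<pi>)"
    by (simp only:)
  also have "\<dots> = ((\<integral>x. cos ((a - b) \<bullet> (K *v x) + (\<theta> - \<phi>)) \<partial>\<pi>) + (\<integral>x. cos ((a + b) \<bullet> (K *v x) + (\<theta> + \<phi>)) \<partial>\<pi>)) / 2"
    by (subst integral_divide_zero, subst Bochner_Integration.integral_add) (rule integrable_cos refl)+
  also have "\<dots> = (exp (- ((a - b) \<bullet> (a - b)) / 2) * cos (\<theta> - \<phi>) + exp (- ((a + b) \<bullet> (a + b)) / 2) * cos (\<theta> + \<phi>)) / 2"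
    by (simp only: gaussian_cos)
  also have "exp (- ((a - b) \<bullet> (a - b)) / 2) = exp (- (a \<bullet> a + b \<bullet> b) / 2) * exp (a \<bullet> b)"
    by (simp add: exp_add[symmetric] inner_diff_left inner_diff_right inner_commute field_simps)
  also have "exp (- ((a + b) \<bullet> (a + b)) / 2) = exp (- (a \<bullet> a + b \<bullet> b) / 2) * exp (- (a \<bullet> b))"
    by (simp add: exp_add[symmetric] inner_add_left inner_add_right inner_commute field_simps)
  finally show ?thesis by (simp add: cos_kernel_def algebra_simps)
qed

lemma L2_fun_bounded:
  assumes "f \<in> borel_measurable borel" "\<And>x. \<bar>f x\<bar> \<le> C"
  shows "L2_fun \<pi> f"
proof -
  have "integrable \<pi> (\<lambda>x. (f x)\<^sup>2)"
  proof (rule integrable_const_bound[of _ "C\<^sup>2"])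
    have "(f x)\<^sup>2 \<le> C\<^sup>2" for x using power_mono[OF assms(2)[of x], of 2] by simp
    then show "AE x in \<pi>. norm ((f x)\<^sup>2) \<le> C\<^sup>2" by simp
  qed (use assms in auto)
  then show ?thesis using assms by (simp add: L2_fun_def)
qed

lemma energy_trig_poly:
  fixes xs defines "f \<equiv> \<lambda>x. trig_poly xs (K *v x)"
  shows "energy f \<le> rate * (\<integral>x. (f x)\<^sup>2 \<partial>\<pi>) + (1 - rate) * (\<integral>x. f x \<partial>\<pi>)\<^sup>2"
proof -
  define J where "J = {..<length xs}"
  define c where "c j = fst (xs ! j)" for j
  define a where "a j = fst (snd (xs ! j))" for j
  define \<theta> where "\<theta> j = snd (snd (xs ! j))" for j
  \<comment> \<open>Absorbing the Gaussian factor of each cosine into its coefficient turns squared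
    mean, squared norm and energy into sums over the same weights, differing only in the argument of
    \<open>cos_kernel\<close>.\<close>
  define d where "d j = c j * exp (- (a j \<bullet> a j) / 2)" for j
  have J: "finite J" by (simp add: J_def)
  have f: "f x = (\<Sum>j\<in>J. c j * cos (a j \<bullet> (K *v x) + \<theta> j))" for x
    unfolding f_def trig_poly_def sum_list_sum_nth
    by (simp add: J_def c_def a_def \<theta>_def split_beta atLeast0LessThan)
  have fm[measurable]: "f \<in> borel_measurable borel"
    unfolding f_def by measurable
  have L2: "L2_fun \<pi> f"
    by (rule L2_fun_bounded[OF fm]) (auto simp: f_def intro: trig_poly_bounded)
  have mean: "(\<integral>x. f x \<partial>\<pi>) = (\<Sum>j\<in>J. d j * cos (\<theta> j))"
    unfolding f by (simp add: integrable_cos gaussian_cos d_def mult.assoc)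
  have mean2: "(\<integral>x. f x \<partial>\<pi>)\<^sup>2 = (\<Sum>j\<in>J. \<Sum>l\<in>J. d j * d l * cos_kernel 0 (\<theta> j) (\<theta> l))"
    unfolding mean power2_eq_square sum_product cos_kernel_0 by (simp add: mult_ac)
  have icc: "integrable \<pi> (\<lambda>x. cos (b \<bullet> (K *v x) + s) * cos (b' \<bullet> (K *v x) + s'))" for b b' s s'
    by (rule integrable_const_bound[of _ 1]) (auto simp: abs_mult intro!: mult_le_one)
  have cross: "(\<integral>x. f x * (\<Sum>l\<in>J. e l * cos (b l \<bullet> (K *v x) + \<theta> l)) \<partial>\<pi>) =
      (\<Sum>j\<in>J. \<Sum>l\<in>J. c j * e l * (exp (- (a j \<bullet> a j + b l \<bullet> b l) / 2) * cos_kernel (a j \<bullet> b l) (\<theta> j) (\<theta> l)))" for e b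
  proof -
    have "(\<integral>x. f x * (\<Sum>l\<in>J. e l * cos (b l \<bullet> (K *v x) + \<theta> l)) \<partial>\<pi>) =
        (\<integral>x. (\<Sum>j\<in>J. \<Sum>l\<in>J. c j * e l * (cos (a j \<bullet> (K *v x) + \<theta> j) * cos (b l \<bullet> (K *v x) + \<theta> l))) \<partial>\<pi>)"
      unfolding f sum_product by (simp add: mult_ac)
    also have "\<dots> = (\<Sum>j\<in>J. \<Sum>l\<in>J. c j * e l * (\<integral>x. cos (a j \<bullet> (K *v x) + \<theta> j) * cos (b l \<bullet> (K *v x) + \<theta> l) \<partial>\<pi>))"
      by (simp add: icc)
    finally show ?thesis by (simp add: integral_cos_cos)
  qed
  have sq: "(\<integral>x. (f x)\<^sup>2 \<partial>\<pi>) = (\<Sum>j\<in>J. \<Sum>l\<in>J. d j * d l * cos_kernel (a j \<bullet> a l) (\<theta> j) (\<theta> l))"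
  proof -
    have "(\<integral>x. (f x)\<^sup>2 \<partial>\<pi>) = (\<integral>x. f x * (\<Sum>l\<in>J. c l * cos (a l \<bullet> (K *v x) + \<theta> l)) \<partial>\<pi>)"
      by (simp add: power2_eq_square f[symmetric])
    also have "\<dots> = (\<Sum>j\<in>J. \<Sum>l\<in>J. d j * d l * cos_kernel (a j \<bullet> a l) (\<theta> j) (\<theta> l))"
      unfolding cross
    proof (intro sum.cong refl)
      fix j l
      have "exp (- (a j \<bullet> a j + a l \<bullet> a l) / 2) = exp (- (a j \<bullet> a j) / 2) * exp (- (a l \<bullet> a l) / 2)"
        by (simp add: exp_add[symmetric] field_simps)
      then show "c j * c l * (exp (- (a j \<bullet> a j + a l \<bullet> a l) / 2) * cos_kernel (a j \<bullet> a l) (\<theta> j) (\<theta> l)) =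
          d j * d l * cos_kernel (a j \<bullet> a l) (\<theta> j) (\<theta> l)"
        by (simp add: d_def mult_ac)
    qed
    finally show ?thesis .
  qed
  have en: "(\<integral>x. (E i f x)\<^sup>2 \<partial>\<pi>) = (\<Sum>j\<in>J. \<Sum>l\<in>J. d j * d l * cos_kernel (a j \<bullet> P i (a l)) (\<theta> j) (\<theta> l))" for i
  proof -
    \<comment> \<open>The damping of the l-th cosine when the component R_i a_l of its frequency is
      averaged out; the component P_i a_l survives.\<close>
    define e where "e l = c l * exp (- (R i (a l) \<bullet> R i (a l)) / 2)" for l
    define G where "G x = (\<Sum>l\<in>J. e l * cos (P i (a l) \<bullet> (K *v x) + \<theta> l))" for x
    have Gm[measurable]: "G \<in> borel_measurable borel" unfolding G_def by measurable
    have "AE x in \<pi>. E i f x = G x"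
    proof (rule E_resample)
      show "integrable \<pi> f" by (rule L2_fun_integrable[OF L2])
      show "integrable \<pi> G" unfolding G_def by (simp add: integrable_cos)
      fix x
      have "(\<integral>y. f (x - B i *v x + B i *v y) \<partial>\<pi>) =
          (\<integral>y. (\<Sum>l\<in>J. c l * cos (R i (a l) \<bullet> (K *v y) + (P i (a l) \<bullet> (K *v x) + \<theta> l))) \<partial>\<pi>)"
        unfolding f K_resample inner_add_right P_symmetric R_symmetric by (simp add: add_ac)
      also have "\<dots> = G x"
        by (simp add: integrable_cos gaussian_cos G_def e_def mult.assoc)
      finally show "(\<integral>y. f (x - B i *v x + B i *v y) \<partial>\<pi>) = G x" .
    next
      fix x x' assume "same_off blk i x x'"
      then show "G x = G x'" unfolding G_def P_symmetric[symmetric] by (simp add: P_K_same_off)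
    qed measurable
    then have "(\<integral>x. f x * E i f x \<partial>\<pi>) = (\<integral>x. f x * G x \<partial>\<pi>)"
      by (intro integral_cong_AE) auto
    moreover have "(\<integral>x. (E i f x)\<^sup>2 \<partial>\<pi>) = (\<integral>x. f x * E i f x \<partial>\<pi>)"
      using real_cond_exp_self_adjoint[OF F_sub L2 L2, of i] by (simp add: power2_eq_square)
    ultimately have "(\<integral>x. (E i f x)\<^sup>2 \<partial>\<pi>) = (\<integral>x. f x * G x \<partial>\<pi>)" by simp
    also have "\<dots> = (\<Sum>j\<in>J. \<Sum>l\<in>J. d j * d l * cos_kernel (a j \<bullet> P i (a l)) (\<theta> j) (\<theta> l))"
      unfolding G_def cross
    proof (intro sum.cong refl)
      fix j l
      \<comment> \<open>By Pythagoras the damping by R_i a_l and the Gaussian factor of P_i a_l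
        combine to the factor of a_l, so the weights d_l reappear for every i.\<close>
      have "exp (- (R i (a l) \<bullet> R i (a l)) / 2) * exp (- (a j \<bullet> a j + P i (a l) \<bullet> P i (a l)) / 2)
        = exp (- (a j \<bullet> a j) / 2) * exp (- (a l \<bullet> a l) / 2)"
        unfolding pythagoras[of i "a l", symmetric] by (simp add: exp_add[symmetric] field_simps)
      then show "c j * e l * (exp (- (a j \<bullet> a j + P i (a l) \<bullet> P i (a l)) / 2) * cos_kernel (a j \<bullet> P i (a l)) (\<theta> j) (\<theta> l)) =
          d j * d l * cos_kernel (a j \<bullet> P i (a l)) (\<theta> j) (\<theta> l)"
        by (simp add: d_def e_def mult_ac)
    qed
    finally show ?thesis .
  qed
  \<comment> \<open>Since the p_i sum to 1, the squared mean can be subtracted inside the average,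
    where it cancels the degree zero term of each kernel.\<close>
  have "energy f - (\<integral>x. f x \<partial>\<pi>)\<^sup>2 =
      (\<Sum>j\<in>J. \<Sum>l\<in>J. d j * d l * (\<Sum>i\<in>UNIV. p i * (cos_kernel (a j \<bullet> P i (a l)) (\<theta> j) (\<theta> l) - cos_kernel 0 (\<theta> j) (\<theta> l))))"
  proof -
    have "energy f = (\<Sum>j\<in>J. \<Sum>l\<in>J. d j * d l * (\<Sum>i\<in>UNIV. p i * cos_kernel (a j \<bullet> P i (a l)) (\<theta> j) (\<theta> l)))"
      unfolding en sum_distrib_left
      by (subst sum.swap, intro sum.cong refl, subst sum.swap) (simp add: mult_ac)
    moreover have "(\<Sum>i\<in>UNIV. p i * (cos_kernel (a j \<bullet> P i (a l)) (\<theta> j) (\<theta> l) - cos_kernel 0 (\<theta> j) (\<theta> l))) =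
        (\<Sum>i\<in>UNIV. p i * cos_kernel (a j \<bullet> P i (a l)) (\<theta> j) (\<theta> l)) - cos_kernel 0 (\<theta> j) (\<theta> l)" for j l
      by (simp add: right_diff_distrib sum_subtractf sum_distrib_right[symmetric] p_one)
    ultimately show ?thesis
      by (simp add: mean2 right_diff_distrib sum_subtractf)
  qed
  also have "\<dots> \<le> (\<Sum>j\<in>J. \<Sum>l\<in>J. d j * d l * (rate * (cos_kernel (a j \<bullet> a l) (\<theta> j) (\<theta> l) - cos_kernel 0 (\<theta> j) (\<theta> l))))"
    by (rule PA.cos_kernel_bound[OF J])
  also have "\<dots> = rate * ((\<integral>x. (f x)\<^sup>2 \<partial>\<pi>) - (\<integral>x. f x \<partial>\<pi>)\<^sup>2)"
    unfolding sq mean2 by (simp add: right_diff_distrib sum_subtractf sum_distrib_left mult_ac)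
  finally show ?thesis by (simp add: algebra_simps)
qed

text \<open>The approximation is made in the coordinates u = K x, where \<open>L\<close>, the
  inverse of K, carries f to g; the limit is then pulled back.\<close>

lemma energy_bounded:
  assumes f[measurable]: "f \<in> borel_measurable borel" and bd: "\<And>x. \<bar>f x\<bar> \<le> C"
  shows "energy f \<le> rate * (\<integral>x. (f x)\<^sup>2 \<partial>\<pi>) + (1 - rate) * (\<integral>x. f x \<partial>\<pi>)\<^sup>2"
proof -
  define L where "L = \<Sigma> ** K"
  have "L ** K = mat 1" by (simp add: L_def matrix_mul_assoc[symmetric] K_sq pos_def_mat_inv[OF pd])
  then have LK: "L *v (K *v x) = x" for x by (simp add: matrix_vector_mul_assoc)
  define g where "g u = f (L *v u)" for u
  have [measurable]: "g \<in> borel_measurable borel" unfolding g_def by measurable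
  obtain t where tb: "\<And>n u. \<bar>trig_poly (t n) u\<bar> \<le> C + 1"
    and tl: "AE u in lborel. (\<lambda>n. trig_poly (t n) u) \<longlonglongrightarrow> g u"
    using trig_poly_approx_AE[of g C] bd by (auto simp: g_def)
  have "AE u in std_gauss. (\<lambda>n. trig_poly (t n) u) \<longlonglongrightarrow> g u"
    unfolding std_gauss_def by (subst AE_density) (use tl in auto)
  then have "AE x in \<pi>. (\<lambda>n. trig_poly (t n) (K *v x)) \<longlonglongrightarrow> g (K *v x)"
    unfolding distr_gaussian[symmetric] by (rule AE_distrD[rotated]) simp
  then have lim: "AE x in \<pi>. (\<lambda>n. trig_poly (t n) (K *v x)) \<longlonglongrightarrow> f x" by (simp add: g_def LK)
  show ?thesis
  proof (rule energy_limit)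
    show "L2_fun \<pi> (\<lambda>x. trig_poly (t n) (K *v x))" for n
      by (rule L2_fun_bounded[OF _ tb]) measurable
    show "L2_fun \<pi> (\<lambda>x. C + 1)" by (rule L2_fun_const)
    show "\<bar>trig_poly (t n) (K *v x)\<bar> \<le> C + 1" for n x by (rule tb)
    show "AE x in \<pi>. (\<lambda>n. trig_poly (t n) (K *v x)) \<longlonglongrightarrow> f x" by (rule lim)
  qed (auto intro: energy_trig_poly)
qed

text \<open>Truncation at height n stays below |f|, a square integrable majorant.\<close>

lemma energy_L2:
  assumes f: "L2_fun \<pi> f"
  shows "energy f \<le> rate * (\<integral>x. (f x)\<^sup>2 \<partial>\<pi>) + (1 - rate) * (\<integral>x. f x \<partial>\<pi>)\<^sup>2"
proof -
  have fm[measurable]: "f \<in> borel_measurable borel"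
    using L2_funD(1)[OF f] by (simp only: measurable_cong_sets[OF sets_gaussian refl])
  define g where "g n x = max (- real n) (min (real n) (f x))" for n :: nat and x
  have gm[measurable]: "g n \<in> borel_measurable borel" for n unfolding g_def by measurable
  have gn: "\<bar>g n x\<bar> \<le> real n" for n x unfolding g_def by linarith
  have gf: "\<bar>g n x\<bar> \<le> \<bar>f x\<bar>" for n x unfolding g_def by linarith
  have lim: "(\<lambda>n. g n x) \<longlonglongrightarrow> f x" for x
  proof (rule tendsto_eventually)
    obtain m where m: "\<bar>f x\<bar> \<le> real m" using real_arch_simple by blast
    show "\<forall>\<^sub>F n in sequentially. g n x = f x"
    proof (rule eventually_sequentiallyI[of m])
      fix n assume "m \<le> n"
      then have "\<bar>f x\<bar> \<le> real n" using m by (meson of_nat_mono order_trans)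
      then show "g n x = f x" unfolding g_def by linarith
    qed
  qed
  show ?thesis
  proof (rule energy_limit)
    show "L2_fun \<pi> (g n)" for n by (rule L2_fun_bounded[OF gm gn])
    show "L2_fun \<pi> (\<lambda>x. \<bar>f x\<bar>)" using f by (simp add: L2_fun_def)
    show "\<bar>g n x\<bar> \<le> \<bar>f x\<bar>" for n x by (rule gf)
    show "AE x in \<pi>. (\<lambda>n. g n x) \<longlonglongrightarrow> f x" using lim by simp
    show "energy (g n) \<le> rate * (\<integral>x. (g n x)\<^sup>2 \<partial>\<pi>) + (1 - rate) * (\<integral>x. g n x \<partial>\<pi>)\<^sup>2" for n
      by (rule energy_bounded[OF gm gn])
  qed measurable
qed

section \<open>Iterates of the sampler and their rate of convergence\<close>

abbreviation "rsgs \<equiv> rsgs_op p k"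

lemma rsgs_measurable:
  assumes "f \<in> borel_measurable borel"
  shows "rsgs f \<in> borel_measurable borel"
proof -
  have "(\<lambda>x. \<integral>y. f y \<partial>k i x) \<in> borel_measurable borel" for i
  proof -
    interpret block_kernel \<pi> blk i "k i" by (rule block_kernel)
    show ?thesis by (rule k_integral_measurable[OF assms])
  qed
  then show ?thesis unfolding rsgs_op_def by (intro borel_measurable_sum borel_measurable_times) auto
qed

lemma rsgs_eq_mixture:
  assumes "integrable \<pi> f"
  shows "AE x in \<pi>. rsgs f x = mixture f x"
proof -
  have "AE x in \<pi>. \<forall>i\<in>UNIV. E i f x = (\<integral>y. f y \<partial>k i x)"
    by (rule AE_finite_allI) (simp_all add: block_kernel.real_cond_exp_block_kernel[OF block_kernel assms])
  then show ?thesis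
    by eventually_elim (simp add: rsgs_op_def mixture_def)
qed

lemma borel_pi: "borel_measurable \<pi> = borel_measurable borel"
  by (rule measurable_cong_sets[OF sets_gaussian refl])

text \<open>A number c strictly above the eigenvalue is positive even if the eigenvalue is 0, as
  \<open>mixture_contraction\<close> demands.\<close>

lemma rsgs_step:
  assumes c: "c > rate" and f: "L2_fun \<pi> f"
  shows "L2_fun \<pi> (rsgs f)" "(\<integral>x. rsgs f x \<partial>\<pi>) = (\<integral>x. f x \<partial>\<pi>)"
    "(\<integral>x. (rsgs f x - (\<integral>y. f y \<partial>\<pi>))\<^sup>2 \<partial>\<pi>) \<le> c\<^sup>2 * (\<integral>x. (f x - (\<integral>y. f y \<partial>\<pi>))\<^sup>2 \<partial>\<pi>)"
proof -
  define m where "m = (\<integral>y. f y \<partial>\<pi>)"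
  have fi: "integrable \<pi> f" by (rule L2_fun_integrable[OF f])
  have fm: "f \<in> borel_measurable borel" using L2_funD(1)[OF f] by (simp only: borel_pi)
  have rm[measurable]: "rsgs f \<in> borel_measurable borel" by (rule rsgs_measurable[OF fm])
  have mm[measurable]: "mixture h \<in> borel_measurable borel" if "L2_fun \<pi> h" for h
    using L2_funD(1)[OF L2_fun_mixture[OF that]] by (simp only: borel_pi)
  have ae: "AE x in \<pi>. mixture f x = rsgs f x"
    using rsgs_eq_mixture[OF fi] by eventually_elim simp
  show "L2_fun \<pi> (rsgs f)"
    by (rule L2_fun_AE_cong[OF L2_fun_mixture[OF f] ae]) simp
  have "(\<integral>x. rsgs f x \<partial>\<pi>) = (\<integral>x. mixture f x \<partial>\<pi>)"
    by (rule integral_cong_AE) (use ae mm[OF f] in auto)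
  then show "(\<integral>x. rsgs f x \<partial>\<pi>) = (\<integral>x. f x \<partial>\<pi>)" by (simp add: integral_mixture[OF f])
  define h where "h x = f x - m" for x
  have h: "L2_fun \<pi> h" unfolding h_def by (intro L2_fun_diff f L2_fun_const)
  have h0: "(\<integral>x. h x \<partial>\<pi>) = 0" unfolding h_def using fi prob_space by (simp add: m_def)
  \<comment> \<open>Conditional expectations fix constants, so contraction for the centred h is
    contraction of f towards its mean.\<close>
  have "AE x in \<pi>. \<forall>i\<in>UNIV. E i h x = E i f x - m"
  proof (rule AE_finite_allI)
    fix i
    interpret finite_measure_subalgebra \<pi> "off_algebra blk i"
      by standard (rule subalgebra_off_algebra[OF sets_gaussian])
    have "AE x in \<pi>. E i h x = E i f x - E i (\<lambda>_. m) x"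
      unfolding h_def using fi by (intro real_cond_exp_diff) auto
    moreover have "AE x in \<pi>. E i (\<lambda>_. m) x = m" by (rule real_cond_exp_F_meas) auto
    ultimately show "AE x in \<pi>. E i h x = E i f x - m" by eventually_elim simp
  qed simp
  with ae have "AE x in \<pi>. rsgs f x - m = mixture h x"
  proof eventually_elim
    case (elim x)
    then have "mixture h x = (\<Sum>i\<in>UNIV. p i * E i f x) - (\<Sum>i\<in>UNIV. p i) * m"
      by (simp add: mixture_def right_diff_distrib sum_subtractf sum_distrib_right)
    then show ?case using elim by (simp add: mixture_def p_one)
  qed
  then have "(\<integral>x. (rsgs f x - m)\<^sup>2 \<partial>\<pi>) = (\<integral>x. (mixture h x)\<^sup>2 \<partial>\<pi>)"
    by (intro integral_cong_AE) (use mm[OF h] in auto)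
  also have "\<dots> \<le> c\<^sup>2 * (\<integral>x. (h x)\<^sup>2 \<partial>\<pi>)"
  proof (rule mixture_contraction[OF _ _ h h0])
    show "c > 0" using c rate_nonneg by linarith
    fix g assume g: "L2_fun \<pi> g" "(\<integral>x. g x \<partial>\<pi>) = 0"
    have "energy g \<le> rate * (\<integral>x. (g x)\<^sup>2 \<partial>\<pi>)" using energy_L2[OF g(1)] g(2) by simp
    also have "\<dots> \<le> c * (\<integral>x. (g x)\<^sup>2 \<partial>\<pi>)" using c by (intro mult_right_mono) auto
    finally show "energy g \<le> c * (\<integral>x. (g x)\<^sup>2 \<partial>\<pi>)" .
  qed
  finally show "(\<integral>x. (rsgs f x - (\<integral>y. f y \<partial>\<pi>))\<^sup>2 \<partial>\<pi>) \<le> c\<^sup>2 * (\<integral>x. (f x - (\<integral>y. f y \<partial>\<pi>))\<^sup>2 \<partial>\<pi>)"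
    by (simp add: h_def m_def)
qed

lemma rsgs_power:
  assumes c: "c > rate" and f: "L2_fun \<pi> f"
  shows "L2_fun \<pi> ((rsgs ^^ n) f) \<and> (\<integral>x. (rsgs ^^ n) f x \<partial>\<pi>) = (\<integral>x. f x \<partial>\<pi>) \<and>
    (\<integral>x. ((rsgs ^^ n) f x - (\<integral>y. f y \<partial>\<pi>))\<^sup>2 \<partial>\<pi>) \<le> c ^ (2 * n) * (\<integral>x. (f x - (\<integral>y. f y \<partial>\<pi>))\<^sup>2 \<partial>\<pi>)"
proof (induction n)
  case (Suc n)
  let ?g = "(rsgs ^^ n) f"
  have g: "L2_fun \<pi> ?g" "(\<integral>x. ?g x \<partial>\<pi>) = (\<integral>x. f x \<partial>\<pi>)" using Suc by auto
  note s = rsgs_step[OF c g(1), unfolded g(2)]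
  have "(\<integral>x. (rsgs ?g x - (\<integral>y. f y \<partial>\<pi>))\<^sup>2 \<partial>\<pi>) \<le> c\<^sup>2 * (c ^ (2 * n) * (\<integral>x. (f x - (\<integral>y. f y \<partial>\<pi>))\<^sup>2 \<partial>\<pi>))"
    using s(3) Suc by (meson mult_left_mono order_trans zero_le_power2)
  then show ?case using s(1,2) by (simp add: power2_eq_square mult_ac)
qed (use f in simp)

definition rate_set :: "real set" where
  "rate_set = {\<rho>. \<rho> > 0 \<and> (\<forall>f. L2_fun \<pi> f \<longrightarrow> (\<forall>r > \<rho>.
      (\<lambda>n. (1 / r) ^ (2 * n) * (\<integral>x. ((rsgs ^^ n) f x - (\<integral>y. f y \<partial>\<pi>))^2 \<partial>\<pi>)) \<longlonglongrightarrow> 0))}"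

lemma rate_set_upper:
  assumes c: "c > rate"
  shows "c \<in> rate_set"
proof -
  have c0: "c > 0" using c rate_nonneg by linarith
  have "(\<lambda>n. (1 / r) ^ (2 * n) * (\<integral>x. ((rsgs ^^ n) f x - (\<integral>y. f y \<partial>\<pi>))\<^sup>2 \<partial>\<pi>)) \<longlonglongrightarrow> 0"
    if f: "L2_fun \<pi> f" and r: "r > c" for f r
  proof -
    define V where "V = (\<integral>x. (f x - (\<integral>y. f y \<partial>\<pi>))\<^sup>2 \<partial>\<pi>)"
    have r0: "r > 0" using r c0 by linarith
    have "(c / r)\<^sup>2 < 1" using c0 r r0 by (simp add: abs_square_less_1)
    then have "(\<lambda>n. ((c / r)\<^sup>2) ^ n * V) \<longlonglongrightarrow> 0 * V"
      by (intro tendsto_mult tendsto_const LIMSEQ_realpow_zero) auto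
    then have lim: "(\<lambda>n. ((c / r)\<^sup>2) ^ n * V) \<longlonglongrightarrow> 0" by simp
    have up: "(1 / r) ^ (2 * n) * (\<integral>x. ((rsgs ^^ n) f x - (\<integral>y. f y \<partial>\<pi>))\<^sup>2 \<partial>\<pi>) \<le> ((c / r)\<^sup>2) ^ n * V" for n
    proof -
      have "(1 / r) ^ (2 * n) * (\<integral>x. ((rsgs ^^ n) f x - (\<integral>y. f y \<partial>\<pi>))\<^sup>2 \<partial>\<pi>) \<le> (1 / r) ^ (2 * n) * (c ^ (2 * n) * V)"
        using rsgs_power[OF c f, of n] r0 unfolding V_def by (intro mult_left_mono) auto
      also have "\<dots> = ((c / r)\<^sup>2) ^ n * V" by (simp add: power_mult[symmetric] power_divide)
      finally show ?thesis .
    qed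
    have low: "0 \<le> (1 / r) ^ (2 * n) * (\<integral>x. ((rsgs ^^ n) f x - (\<integral>y. f y \<partial>\<pi>))\<^sup>2 \<partial>\<pi>)" for n
      using r0 by (intro mult_nonneg_nonneg) auto
    show ?thesis
      by (rule tendsto_sandwich[OF always_eventually always_eventually tendsto_const lim]) (rule allI, rule low up)+
  qed
  then show ?thesis using c0 by (simp add: rate_set_def)
qed

lemma gaussian_linear_mean:
  "integrable \<pi> (\<lambda>x. a \<bullet> (K *v x))" "(\<integral>x. a \<bullet> (K *v x) \<partial>\<pi>) = 0"
proof -
  have "integrable \<pi> (\<lambda>x. a \<bullet> (K *v x)) \<and> (\<integral>x. a \<bullet> (K *v x) \<partial>\<pi>) = 0"
  proof (cases "a = 0")
    case False
    define w where "w = a /\<^sub>R norm a"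
    have w: "norm w = 1" "a = norm a *\<^sub>R w" using False by (auto simp: w_def)
    have "a \<bullet> (K *v x) = norm a * (w \<bullet> (K *v x))" for x by (subst w(2)) simp
    then show ?thesis using gaussian_linear(3,4)[OF w(1)] by simp
  qed simp
  then show "integrable \<pi> (\<lambda>x. a \<bullet> (K *v x))" "(\<integral>x. a \<bullet> (K *v x) \<partial>\<pi>) = 0" by auto
qed

lemma E_linear: "AE x in \<pi>. E i (\<lambda>x. w \<bullet> (K *v x)) x = P i w \<bullet> (K *v x)"
proof (rule E_resample)
  fix x
  have "(\<integral>y. w \<bullet> (K *v (x - B i *v x + B i *v y)) \<partial>\<pi>) = (\<integral>y. P i w \<bullet> (K *v x) + R i w \<bullet> (K *v y) \<partial>\<pi>)"
    unfolding K_resample by (simp add: inner_add_right P_symmetric R_symmetric)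
  also have "\<dots> = P i w \<bullet> (K *v x)"
    using gaussian_linear_mean[of "R i w"] prob_space by simp
  finally show "(\<integral>y. w \<bullet> (K *v (x - B i *v x + B i *v y)) \<partial>\<pi>) = P i w \<bullet> (K *v x)" .
next
  fix x x' assume "same_off blk i x x'"
  then show "P i w \<bullet> (K *v x) = P i w \<bullet> (K *v x')"
    unfolding P_symmetric[symmetric] by (simp add: P_K_same_off)
qed (auto intro: gaussian_linear_mean)

text \<open>The eigenvalue equation holds only almost everywhere, the kernels being versions.
  Measurability is carried through the induction so that E_i may be applied along an almost
  everywhere equality.\<close>

lemma rsgs_power_eigenfunction:
  assumes w: "F1 *v w = rate *\<^sub>R w"
  shows "(rsgs ^^ n) (\<lambda>x. w \<bullet> (K *v x)) \<in> borel_measurable borel \<and>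
    (AE x in \<pi>. (rsgs ^^ n) (\<lambda>x. w \<bullet> (K *v x)) x = rate ^ n * (w \<bullet> (K *v x)))"
proof (induction n)
  case (Suc n)
  define f where "f x = w \<bullet> (K *v x)" for x
  define g where "g = (rsgs ^^ n) f"
  have fi: "integrable \<pi> f" unfolding f_def by (rule gaussian_linear_mean)
  have fm[measurable]: "f \<in> borel_measurable borel" unfolding f_def by measurable
  have gm[measurable]: "g \<in> borel_measurable borel" and ae: "AE x in \<pi>. g x = rate ^ n * f x"
    using Suc by (auto simp: g_def f_def[abs_def])
  have gi: "integrable \<pi> g"
    by (subst integrable_cong_AE[OF _ _ ae]) (use fi in auto)
  have "AE x in \<pi>. \<forall>i\<in>UNIV. E i g x = rate ^ n * (P i w \<bullet> (K *v x))"
  proof (rule AE_finite_allI)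
    fix i
    interpret finite_measure_subalgebra \<pi> "off_algebra blk i"
      by standard (rule subalgebra_off_algebra[OF sets_gaussian])
    have "AE x in \<pi>. E i g x = E i (\<lambda>x. rate ^ n * f x) x"
      by (rule real_cond_exp_cong[OF ae]) auto
    moreover have "AE x in \<pi>. E i (\<lambda>x. rate ^ n * f x) x = rate ^ n * E i f x"
      by (rule real_cond_exp_cmult[OF fi])
    moreover have "AE x in \<pi>. E i f x = P i w \<bullet> (K *v x)"
      unfolding f_def by (rule E_linear)
    ultimately show "AE x in \<pi>. E i g x = rate ^ n * (P i w \<bullet> (K *v x))" by eventually_elim simp
  qed simp
  with rsgs_eq_mixture[OF gi] have "AE x in \<pi>. rsgs g x = rate ^ Suc n * f x"
  proof eventually_elim
    case (elim x)
    then have "rsgs g x = rate ^ n * ((\<Sum>i\<in>UNIV. p i *\<^sub>R P i w) \<bullet> (K *v x))"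
      by (simp add: mixture_def inner_sum_left sum_distrib_left mult_ac)
    then show ?case by (simp add: F1_mult[symmetric] w f_def)
  qed
  then show ?case using rsgs_measurable[OF gm] by (simp add: g_def f_def[abs_def])
qed simp

lemma rate_set_lower:
  assumes \<rho>: "\<rho> \<in> rate_set"
  shows "rate \<le> \<rho>"
proof (rule ccontr)
  assume "\<not> rate \<le> \<rho>"
  then have less: "\<rho> < rate" by simp
  then have pos: "rate > 0" using \<rho> by (auto simp: rate_set_def)
  from lambda_max_symmetric(1)[OF F1_symmetric]
  obtain v where v: "v \<noteq> 0" "F1 *v v = rate *\<^sub>R v" by (elim exE conjE)
  define w where "w = v /\<^sub>R norm v"
  have w: "norm w = 1" "F1 *v w = rate *\<^sub>R w"
    using v by (auto simp: w_def matrix_vector_mult_scaleR)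
  define f where "f x = w \<bullet> (K *v x)" for x
  have fm[measurable]: "f \<in> borel_measurable borel" unfolding f_def by measurable
  have f: "L2_fun \<pi> f" using gaussian_linear(1)[OF w(1)] by (simp add: L2_fun_def f_def[abs_def])
  have m: "(\<integral>x. f x \<partial>\<pi>) = 0" unfolding f_def by (rule gaussian_linear_mean)
  have "(1 / rate) ^ (2 * n) * (\<integral>x. ((rsgs ^^ n) f x - (\<integral>y. f y \<partial>\<pi>))\<^sup>2 \<partial>\<pi>) = 1" for n
  proof -
    have e: "(rsgs ^^ n) f \<in> borel_measurable borel" "AE x in \<pi>. (rsgs ^^ n) f x = rate ^ n * f x"
      using rsgs_power_eigenfunction[OF w(2), of n] by (auto simp: f_def[abs_def])
    note [measurable] = e(1)
    have "(\<integral>x. ((rsgs ^^ n) f x - (\<integral>y. f y \<partial>\<pi>))\<^sup>2 \<partial>\<pi>) = (\<integral>x. rate ^ (2 * n) * (f x)\<^sup>2 \<partial>\<pi>)"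
      by (rule integral_cong_AE) (use e(2) m in \<open>auto simp: power_mult_distrib power_mult[symmetric] mult.commute\<close>)
    also have "\<dots> = rate ^ (2 * n)" using gaussian_linear(2)[OF w(1)] by (simp add: f_def)
    finally show ?thesis using pos by (simp add: power_divide)
  qed
  \<comment> \<open>The eigenvalue itself exceeds \<open>\<rho>\<close> and may serve as
    \<open>r\<close>; for the normalised eigenfunction the rescaled sequence is then constantly
    1.\<close>
  moreover have "(\<lambda>n. (1 / rate) ^ (2 * n) * (\<integral>x. ((rsgs ^^ n) f x - (\<integral>y. f y \<partial>\<pi>))\<^sup>2 \<partial>\<pi>)) \<longlonglongrightarrow> 0"
    using \<rho> f less unfolding rate_set_def by blast
  ultimately have "(\<lambda>n::nat. 1::real) \<longlonglongrightarrow> 0" by simp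
  then show False by (simp add: LIMSEQ_const_iff)
qed

text \<open>The eigenvalue need not belong to \<open>rate_set\<close>, for instance when it is 0;
  all larger numbers do, and that determines the infimum.\<close>

lemma l2_rate_rsgs: "l2_rate \<pi> rsgs = rate"
proof -
  have bdd: "bdd_below rate_set" using rate_set_lower by (intro bdd_belowI) 
  have "Inf rate_set = rate"
  proof (rule antisym)
    show "Inf rate_set \<le> rate"
      by (rule dense_ge) (intro cInf_lower rate_set_upper bdd)
    have "rate_set \<noteq> {}" using rate_set_upper[of "rate + 1"] by auto
    then show "rate \<le> Inf rate_set" by (rule cInf_greatest) (rule rate_set_lower)
  qed
  then show ?thesis by (simp add: l2_rate_def rate_set_def)
qed

end

theorem theorem1:
  fixes \<Sigma> K :: "real^'n^'n"
    and blk :: "'n \<Rightarrow> 'b::finite"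
    and p :: "'b \<Rightarrow> real"
    and Pr :: "'b \<Rightarrow> real^'n \<Rightarrow> (real^'n) measure"
  assumes "pos_def_mat \<Sigma>"
    and "surj blk"
    and "\<And>i. p i > 0" and "(\<Sum>i\<in>UNIV. p i) = 1"
    and "\<And>i. is_block_conditional (gaussian \<Sigma>) blk i (Pr i)"
    and "transpose K = K" and "\<And>x. x \<bullet> (K *v x) \<ge> 0" and "K ** K = matrix_inv \<Sigma>"
  shows "l2_gap (gaussian \<Sigma>) (rsgs_op p Pr)
       = 1 - lambda_max (mat 1 - K ** (\<Sum>i\<in>UNIV. p i *\<^sub>R block_inv blk (matrix_inv \<Sigma>) i) ** K)"
proof -
  interpret gibbs \<Sigma> K blk p Pr by standard (use assms in auto)
  show ?thesis using l2_rate_rsgs by (simp add: l2_gap_def F1_def)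
qed

end
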